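(* Let $k\ge2$, $l>0$, $r=2k+l-1$. The subspace $\mathfrak p\subset S^2(V_e)$ can be identified with the space of all quadratic polynomials (in the linear coordinates $x_1,\dots,x_r$ on $V_f$) that vanish on the $(k-2)$-th tangential developable variety $\mathcal T^{k-2}C$ of the rational normal curve $C$. For every $n\geq 0$ the $n$-th (standard) prolongation $\mathfrak p^{(n)}$ of $\mathfrak p$ is contained in $I_{n+2}(\mathcal V)$, where $\mathcal V=\mathcal S_{n+1}(\mathcal T^{k-2}C)$ is the $(n+1)$-th secant variety of $\mathcal T^{k-2}C$.
   Context: $V=V_e\oplus V_f$ is a real vector space with bases $e_1,\dots,e_r$ of $V_e$ and $f_1,\dots,f_r$ of $V_f$, and symplectic form $\sigma(e_i,e_j)=\sigma(f_i,f_j)=0$, $\sigma(e_i,f_{r+1-i})=(-1)^i$, $\sigma(e_i,f_j)=0$ for $i+j\ne r+1$. $\mathfrak{sl}(2,\mathbb R)=\langle X,H,Y\rangle$ acts on $V$ by $Xe_i=e_{i+1}$, $Xf_i=f_{i+1}$ $(i<r)$, $Xe_r=Xf_r=0$; $He_i=(r+1-2i)e_i$, $Hf_i=(r+1-2i)f_i$; $Ye_i=(i-1)(r+1-i)e_{i-1}$, $Yf_i=(i-1)(r+1-i)f_{i-1}$ $(i\ge2)$, $Ye_1=Yf_1=0$. Via $\sigma$ we identify $V_e\cong V_f^*$; the elements $A\in\operatorname{Hom}(V_f,V_e)\subset\mathfrak{gl}(V)$ infinitesimally preserving $\sigma$ form $S^2(V_e)\cong S^2(V_f^* )$, i.e.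 $A$ corresponds to the quadratic polynomial $v\mapsto\sigma(Av,v)$ (up to a constant factor) on $V_f$, a polynomial in the linear functions $x_i:=\sigma(e_i,\cdot)$ on $V_f$. As an $\mathfrak{sl}(2,\mathbb R)$-module $S^2(V_e)=\Pi_{2r-2}\oplus\Pi_{2r-6}\oplus\cdots$, $\Pi_m$ being irreducible of dimension $m+1$, and $\mathfrak p$ is the sum of $\Pi_{2l},\Pi_{2l-4},\dots$ (down to $\Pi_2$ or $\Pi_0$). $C\subset\mathbb P V_f=\mathbb P^{r-1}$ is the rational normal curve which is the closure of the orbit of the line $\mathbb Rf_1$ under $\exp(tX)$. $\mathcal T^sC$ is the $s$-th tangential developable variety (closure of the union of the osculating $s$-planes of $C$), $\mathcal T^0C=C$. For a variety $\mathcal V\subset\mathbb P^{r-1}$, $I_m(\mathcal V)$ is the space of homogeneous polynomials of degree $m$ in $x_1,\dots,x_r$ vanishing on $\mathcal V$; $\mathcal S_m\mathcal V$ is the algebraic closure of the union of $(m-1)$-planes passing through $m$ points of $\mathcal V$, $\mathcal S_1\mathcal V=\mathcal V$. Standard prolongation: $\mathfrak p^{(0)}=\mathfrak p$, $\mathfrak p^{(1)}=\{\phi\in\operatorname{Hom}(V,\mathfrak p):\phi(v_1)v_2=\phi(v_2)v_1\}$, and $\mathfrak p^{(n)}=\{\phi\in\operatorname{Hom}(V,\mathfrak p^{(n-1)}):\phi(v_1)(v_2)=\phi(v_2)(v_1)\ \forall v_1,v_2\}$. Elements of $\mathfrak p^{(n)}$ are identified with homogeneous polynomials $F$ of degree $n+2$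 on $V_f$, $F(v)=\sigma(\phi(v,\dots,v)v,v)$ (up to a constant factor); equivalently $\mathfrak p^{(n)}$ is the space of degree $n+2$ polynomials in $x_1,\dots,x_r$ all of whose $n$-th order partial derivatives belong to $\mathfrak p$. *)

theory Defs
  imports "HOL-Analysis.Analysis"
begin

text \<open>
  The norm and inner product of the type class play no role; the class only says that the ambient
  type is a finite-dimensional real vector space, so that gl(V) is the type of bounded linear
  endomorphisms and derivatives of curves in V are available. Indices of bases start at 1.
\<close>

locale sl2_symplectic_space =
  fixes r :: nat
    and e f :: "nat \<Rightarrow> 'v::euclidean_space"
    and \<sigma> :: "'v \<Rightarrow> 'v \<Rightarrow> real"
    and X H Y :: "'v \<Rightarrow>\<^sub>L 'v"
  assumes basis_independent: "independent (e ` {1..r} \<union> f ` {1..r})"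
    and basis_card: "card (e ` {1..r} \<union> f ` {1..r}) = 2 * r"
    and basis_span: "span (e ` {1..r} \<union> f ` {1..r}) = UNIV"
    and \<sigma>_bilinear: "bilinear \<sigma>"
    and \<sigma>_skew: "\<sigma> u v = - \<sigma> v u"
    and \<sigma>_ee: "\<lbrakk>i \<in> {1..r}; j \<in> {1..r}\<rbrakk> \<Longrightarrow> \<sigma> (e i) (e j) = 0"
    and \<sigma>_ff: "\<lbrakk>i \<in> {1..r}; j \<in> {1..r}\<rbrakk> \<Longrightarrow> \<sigma> (f i) (f j) = 0"
    and \<sigma>_ef: "\<lbrakk>i \<in> {1..r}; j \<in> {1..r}\<rbrakk> \<Longrightarrow>
                  \<sigma> (e i) (f j) = (if i + j = r + 1 then (-1) ^ i else 0)"
    and X_e: "i \<in> {1..r} \<Longrightarrow> X (e i) = (if i < r then e (i + 1) else 0)"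
    and X_f: "i \<in> {1..r} \<Longrightarrow> X (f i) = (if i < r then f (i + 1) else 0)"
    and H_e: "i \<in> {1..r} \<Longrightarrow> H (e i) = (real r + 1 - 2 * real i) *\<^sub>R e i"
    and H_f: "i \<in> {1..r} \<Longrightarrow> H (f i) = (real r + 1 - 2 * real i) *\<^sub>R f i"
    and Y_e: "i \<in> {1..r} \<Longrightarrow>
                Y (e i) = (if 2 \<le> i then ((real i - 1) * (real r + 1 - real i)) *\<^sub>R e (i - 1) else 0)"
    and Y_f: "i \<in> {1..r} \<Longrightarrow>
                Y (f i) = (if 2 \<le> i then ((real i - 1) * (real r + 1 - real i)) *\<^sub>R f (i - 1) else 0)"

text \<open>Elements of Hom(Vf, Ve) are the endomorphisms of V that vanish on Ve and take values in Ve.\<close>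

definition sym2 :: "nat \<Rightarrow> (nat \<Rightarrow> 'v) \<Rightarrow> ('v \<Rightarrow> 'v \<Rightarrow> real) \<Rightarrow> ('v::euclidean_space \<Rightarrow>\<^sub>L 'v) set"
  where "sym2 r e \<sigma> =
    {A :: 'v \<Rightarrow>\<^sub>L 'v. (\<forall>u \<in> span (e ` {1..r}). A u = 0) \<and> (\<forall>u. A u \<in> span (e ` {1..r})) \<and>
        (\<forall>u v. \<sigma> (A u) v + \<sigma> u (A v) = 0)}"

definition lie_bracket :: "('v::euclidean_space \<Rightarrow>\<^sub>L 'v) \<Rightarrow> ('v \<Rightarrow>\<^sub>L 'v) \<Rightarrow> ('v \<Rightarrow>\<^sub>L 'v)"
  where "lie_bracket A B = (A o\<^sub>L B) - (B o\<^sub>L A)"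

definition sl2_submodule ::
  "('v::euclidean_space \<Rightarrow>\<^sub>L 'v) \<Rightarrow> ('v \<Rightarrow>\<^sub>L 'v) \<Rightarrow> ('v \<Rightarrow>\<^sub>L 'v) \<Rightarrow> ('v \<Rightarrow>\<^sub>L 'v) set \<Rightarrow> bool"
  where "sl2_submodule X H Y U \<longleftrightarrow>
    subspace U \<and> (\<forall>A\<in>U. lie_bracket X A \<in> U \<and> lie_bracket H A \<in> U \<and> lie_bracket Y A \<in> U)"

definition sl2_irreducible ::
  "('v::euclidean_space \<Rightarrow>\<^sub>L 'v) \<Rightarrow> ('v \<Rightarrow>\<^sub>L 'v) \<Rightarrow> ('v \<Rightarrow>\<^sub>L 'v) \<Rightarrow> ('v \<Rightarrow>\<^sub>L 'v) set \<Rightarrow> bool"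
  where "sl2_irreducible X H Y U \<longleftrightarrow>
    sl2_submodule X H Y U \<and> U \<noteq> {0} \<and>
    (\<forall>W. sl2_submodule X H Y W \<and> W \<subseteq> U \<longrightarrow> W = {0} \<or> W = U)"

text \<open>
  The summand of S2(Ve) that is irreducible of dimension m + 1. S2(Ve) is multiplicity free, so
  the sum below has at most one term; writing it as a sum avoids a definite description.
\<close>

definition irr_component ::
  "nat \<Rightarrow> (nat \<Rightarrow> 'v::euclidean_space) \<Rightarrow> ('v \<Rightarrow> 'v \<Rightarrow> real) \<Rightarrow>
   ('v \<Rightarrow>\<^sub>L 'v) \<Rightarrow> ('v \<Rightarrow>\<^sub>L 'v) \<Rightarrow> ('v \<Rightarrow>\<^sub>L 'v) \<Rightarrow> nat \<Rightarrow> ('v \<Rightarrow>\<^sub>L 'v) set"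
  where "irr_component r e \<sigma> X H Y m =
    span (\<Union>{U. U \<subseteq> sym2 r e \<sigma> \<and> sl2_irreducible X H Y U \<and> dim U = m + 1})"

definition p_module ::
  "nat \<Rightarrow> (nat \<Rightarrow> 'v::euclidean_space) \<Rightarrow> ('v \<Rightarrow> 'v \<Rightarrow> real) \<Rightarrow>
   ('v \<Rightarrow>\<^sub>L 'v) \<Rightarrow> ('v \<Rightarrow>\<^sub>L 'v) \<Rightarrow> ('v \<Rightarrow>\<^sub>L 'v) \<Rightarrow> nat \<Rightarrow> ('v \<Rightarrow>\<^sub>L 'v) set"
  where "p_module r e \<sigma> X H Y l =
    span (\<Union>j\<in>{j. 4 * j \<le> 2 * l}. irr_component r e \<sigma> X H Y (2 * l - 4 * j))"

text \<open>
  The iterated Hom spaces have a different type for every n, so an element of the n-th prolongation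
  is stored in uncurried form as \<open>\<phi> [v\<^sub>1, \<dots>, v\<^sub>n, v] = \<phi>(v\<^sub>1)\<dots>(v\<^sub>n) v\<close>, extended by 0 to lists of
  length other than n + 1. The swap condition is \<open>\<phi>(v\<^sub>1)(v\<^sub>2) = \<phi>(v\<^sub>2)(v\<^sub>1)\<close>
  (\<open>\<phi>(v\<^sub>1) v\<^sub>2 = \<phi>(v\<^sub>2) v\<^sub>1\<close> for the first prolongation).
\<close>

fun prolongation :: "('v::euclidean_space \<Rightarrow>\<^sub>L 'v) set \<Rightarrow> nat \<Rightarrow> ('v list \<Rightarrow> 'v) set"
  where
    "prolongation \<pp> 0 = {\<phi>. \<exists>A\<in>\<pp>. \<phi> = (\<lambda>vs. if length vs = 1 then A (hd vs) else 0)}"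
  | "prolongation \<pp> (Suc n) =
      {\<phi>. \<phi> [] = 0 \<and>
          (\<forall>v. (\<lambda>vs. \<phi> (v # vs)) \<in> prolongation \<pp> n) \<and>
          (\<forall>vs. linear (\<lambda>v. \<phi> (v # vs))) \<and>
          (\<forall>v1 v2 vs. \<phi> (v1 # v2 # vs) = \<phi> (v2 # v1 # vs))}"

text \<open>
  A homogeneous polynomial of degree m in the linear coordinates \<open>x\<^sub>i = \<sigma>(e\<^sub>i, \<cdot>)\<close>, regarded as a
  function on Vf (undefined outside Vf). Over the reals the polynomial and the function determine
  each other.
\<close>

definition hom_polys ::
  "nat \<Rightarrow> (nat \<Rightarrow> 'v) \<Rightarrow> (nat \<Rightarrow> 'v) \<Rightarrow> ('v \<Rightarrow> 'v \<Rightarrow> real) \<Rightarrow> nat \<Rightarrow> ('v::euclidean_space \<Rightarrow> real) set"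
  where "hom_polys r e f \<sigma> m =
    {F. \<exists>c. F = (\<lambda>v \<in> span (f ` {1..r}).
          \<Sum>\<alpha> \<in> {\<alpha> \<in> {1..r} \<rightarrow>\<^sub>E {..m}. (\<Sum>i=1..r. \<alpha> i) = m}. c \<alpha> * (\<Prod>i=1..r. \<sigma> (e i) v ^ \<alpha> i))}"

text \<open>Points of a projective space are lines through the origin.\<close>

definition proj_points :: "'v::euclidean_space set \<Rightarrow> 'v set set"
  where "proj_points W = {span {v} | v. v \<in> W \<and> v \<noteq> 0}"

definition vanishing_polys ::
  "nat \<Rightarrow> (nat \<Rightarrow> 'v) \<Rightarrow> (nat \<Rightarrow> 'v) \<Rightarrow> ('v \<Rightarrow> 'v \<Rightarrow> real) \<Rightarrow> nat \<Rightarrow> 'v set set \<Rightarrow>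
   ('v::euclidean_space \<Rightarrow> real) set"
  where "vanishing_polys r e f \<sigma> m S = {F \<in> hom_polys r e f \<sigma> m. \<forall>L\<in>S. \<forall>v\<in>L. F v = 0}"

definition zariski_closure ::
  "nat \<Rightarrow> (nat \<Rightarrow> 'v) \<Rightarrow> (nat \<Rightarrow> 'v) \<Rightarrow> ('v \<Rightarrow> 'v \<Rightarrow> real) \<Rightarrow> 'v::euclidean_space set set \<Rightarrow> 'v set set"
  where "zariski_closure r e f \<sigma> S =
    {L \<in> proj_points (span (f ` {1..r})). \<forall>m. \<forall>F \<in> vanishing_polys r e f \<sigma> m S. \<forall>v\<in>L. F v = 0}"

text \<open>
  The union of the (m-1)-planes through m points is read, as usual for secant varieties, as the
  union of the linear spans of m points.
\<close>

definition secant_variety ::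
  "nat \<Rightarrow> (nat \<Rightarrow> 'v) \<Rightarrow> (nat \<Rightarrow> 'v) \<Rightarrow> ('v \<Rightarrow> 'v \<Rightarrow> real) \<Rightarrow> nat \<Rightarrow> 'v::euclidean_space set set \<Rightarrow>
   'v set set"
  where "secant_variety r e f \<sigma> m S =
    zariski_closure r e f \<sigma> (\<Union>p \<in> {..<m} \<rightarrow>\<^sub>E S. proj_points (span (\<Union>i<m. p i)))"

definition exp_curve :: "('v::euclidean_space \<Rightarrow>\<^sub>L 'v) \<Rightarrow> 'v \<Rightarrow> real \<Rightarrow> 'v"
  where "exp_curve A v t = (\<Sum>j. (t ^ j / fact j) *\<^sub>R (blinfun_apply A ^^ j) v)"

definition rational_normal_curve ::
  "nat \<Rightarrow> (nat \<Rightarrow> 'v) \<Rightarrow> (nat \<Rightarrow> 'v) \<Rightarrow> ('v \<Rightarrow> 'v \<Rightarrow> real) \<Rightarrow> ('v::euclidean_space \<Rightarrow>\<^sub>L 'v) \<Rightarrow> 'v set set"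
  where "rational_normal_curve r e f \<sigma> X =
    zariski_closure r e f \<sigma> {span {exp_curve X (f 1) t} | t. True}"

definition osculating_space :: "nat \<Rightarrow> (real \<Rightarrow> 'v::euclidean_space) \<Rightarrow> real \<Rightarrow> 'v set"
  where "osculating_space s \<gamma> t =
    span ((\<lambda>j. ((\<lambda>g u. vector_derivative g (at u)) ^^ j) \<gamma> t) ` {..s})"

text \<open>
  The curve is covered by two regular parametrisations: the orbit of the line of \<open>f\<^sub>1\<close> under exp(tX),
  and, around the remaining point (the line of \<open>f\<^sub>r\<close>), the orbit of that line under exp(tY). They
  agree where both apply, because exp(tY) maps \<open>f\<^sub>r\<close> to a multiple of
  exp((1/t)X) \<open>f\<^sub>1\<close> for nonzero t.
\<close>

definition osculating_planes_at ::
  "nat \<Rightarrow> (nat \<Rightarrow> 'v) \<Rightarrow> ('v::euclidean_space \<Rightarrow>\<^sub>L 'v) \<Rightarrow> ('v \<Rightarrow>\<^sub>L 'v) \<Rightarrow> nat \<Rightarrow> 'v set \<Rightarrow> 'v set set set"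
  where "osculating_planes_at r f X Y s P =
    {proj_points (osculating_space s \<gamma> t) | \<gamma> t.
       \<gamma> \<in> {exp_curve X (f 1), exp_curve Y (f r)} \<and> span {\<gamma> t} = P}"

definition tangential_developable ::
  "nat \<Rightarrow> (nat \<Rightarrow> 'v) \<Rightarrow> (nat \<Rightarrow> 'v) \<Rightarrow> ('v \<Rightarrow> 'v \<Rightarrow> real) \<Rightarrow>
   ('v::euclidean_space \<Rightarrow>\<^sub>L 'v) \<Rightarrow> ('v \<Rightarrow>\<^sub>L 'v) \<Rightarrow> nat \<Rightarrow> 'v set set"
  where "tangential_developable r e f \<sigma> X Y s =
    zariski_closure r e f \<sigma>
      (\<Union>P \<in> rational_normal_curve r e f \<sigma> X. \<Union>(osculating_planes_at r f X Y s P))"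

definition quadratic_poly ::
  "nat \<Rightarrow> (nat \<Rightarrow> 'v) \<Rightarrow> ('v \<Rightarrow> 'v \<Rightarrow> real) \<Rightarrow> ('v::euclidean_space \<Rightarrow>\<^sub>L 'v) \<Rightarrow> ('v \<Rightarrow> real)"
  where "quadratic_poly r f \<sigma> A = (\<lambda>v \<in> span (f ` {1..r}). \<sigma> (A v) v)"

definition prolongation_poly ::
  "nat \<Rightarrow> (nat \<Rightarrow> 'v) \<Rightarrow> ('v \<Rightarrow> 'v \<Rightarrow> real) \<Rightarrow> nat \<Rightarrow> ('v::euclidean_space list \<Rightarrow> 'v) \<Rightarrow> ('v \<Rightarrow> real)"
  where "prolongation_poly r f \<sigma> n \<phi> =
    (\<lambda>v \<in> span (f ` {1..r}). \<sigma> (\<phi> (replicate (n + 1) v)) v)"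

end

theory Submission
  imports Defs "HOL-Library.Multiset"
begin

text \<open>
  With the given normalisation X lowers and Y raises the H-weight. Write b(i,j) for the entries
  \<open>\<sigma>(A f\<^sub>i, f\<^sub>j)\<close> of A. An element of weight w has b(i,j) nonzero only for w = 2(i + j) - 2(r + 1), so an
  irreducible submodule of dimension at most 2l + 1, having all weights in [-2l, 2l], consists of
  forms with b(i,j) = 0 for \<open>i + j \<le> 2k - 1\<close>. Conversely, differentiating along the curve shows that a
  quadric contains all osculating (k - 2)-planes iff A and all its images under powers of ad X have
  b(i,j) = 0 for \<open>i + j \<le> 2k - 1\<close>; such A form a submodule, hence a sum of irreducible ones, and each
  of these has a lowest weight vector of weight \<open>-n \<ge> -2l\<close>. Being killed by X, that vector satisfies
  b(i+1,j) = -b(i,j+1), which by symmetry forces i + j to be even, i.e. 2l - n to be divisible by 4.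

  For the prolongations, the (n + 2)-linear symmetric form of an element, evaluated at a combination
  of n + 1 points of the variety, expands into terms in which some point occurs twice; each such
  term is the value at that point of a quadric from p.
\<close>

section \<open>sl(2)-modules with bounded weights\<close>

text \<open>At \<open>t = 0\<close>, a quadric containing the osculating planes gives zeros only in
  the square i, j <= k - 1, while the weight bound concerns the triangle i + j <= 2k - 1. The bridge
  is b(i+1,j) + b(i,j+1) = -b'(i,j), where b' are the entries of \<open>lie_bracket X A\<close>.
  Once antidiagonal s - 1 vanishes for all images under powers of ad X, the entries on antidiagonal
  s agree up to sign, so a single zero kills them all. For even s <= 2k - 2 the diagonal entry lies
  in the square; for odd s symmetry supplies the zero, which is why the triangle reaches 2k - 1. The
  triangle condition is stable under ad H and ad Y, but in general not under ad X. Imposing it on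
  all powers of ad X repairs this, and the commutation relations keep H and Y stability. The line of
  f_r is not on the exp(tX) orbit. The osculating planes along exp(tY) are handled by the upper end
  of the weight interval; the converse uses exp(tX) alone. Complete reducibility is obtained from
  lowest weight strings, by induction on the weight; exchanging X and Y turns each statement about
  low weights into one about high weights.\<close>

lemma subspace_scaleR_cancel:
  assumes "subspace W" "c *\<^sub>R v \<in> W" "c \<noteq> 0"
  shows "v \<in> W"
  using subspace_scale[OF assms(1,2), of "inverse c"] assms(3) by simp

text \<open>Eigenvectors with distinct eigenvalues separate: applying \<open>h - a\<close> removes
  the component of eigenvalue \<open>a\<close> and multiplies the others by the nonzero
  \<open>w - a\<close>. For \<open>W = {0}\<close> this is independence of eigenvectors; for a
  submodule it says that weight components stay inside.\<close>

lemma weight_components: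
  fixes h :: "'b::real_vector \<Rightarrow> 'b"
  assumes h: "linear h" and W: "subspace W" "\<And>v. v \<in> W \<Longrightarrow> h v \<in> W"
    and fin: "finite I"
    and "\<And>w. w \<in> I \<Longrightarrow> h (v w) = w *\<^sub>R v w" and "(\<Sum>w\<in>I. v w) \<in> W"
  shows "\<forall>w\<in>I. v w \<in> W"
  using fin assms(5,6)
proof (induction I arbitrary: v rule: finite_induct)
  case empty
  then show ?case by simp
next
  case (insert a I)
  interpret h: linear h by fact
  let ?s = "\<Sum>w\<in>insert a I. v w"
  have "h ?s - a *\<^sub>R ?s = (\<Sum>w\<in>insert a I. (w - a) *\<^sub>R v w)"
    unfolding h.sum scaleR_sum_right sum_subtractf[symmetric]
    by (rule sum.cong) (use insert.prems(1) in \<open>auto simp: scaleR_left_diff_distrib\<close>)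
  also have "\<dots> = (\<Sum>w\<in>I. (w - a) *\<^sub>R v w)"
    using insert.hyps by simp
  moreover have "h ?s - a *\<^sub>R ?s \<in> W"
    using W insert.prems(2) by (intro subspace_diff subspace_scale) simp_all
  ultimately have "(\<Sum>w\<in>I. (w - a) *\<^sub>R v w) \<in> W"
    by simp
  then have "\<forall>w\<in>I. (w - a) *\<^sub>R v w \<in> W"
    by (intro insert.IH) (auto simp: h.scale insert.prems(1))
  then have I: "\<forall>w\<in>I. v w \<in> W"
    using subspace_scaleR_cancel[OF W(1)] insert.hyps by (metis eq_iff_diff_eq_0)
  have "?s - (\<Sum>w\<in>I. v w) = v a" using insert.hyps by simp
  moreover have "?s - (\<Sum>w\<in>I. v w) \<in> W"
    using I by (intro subspace_diff subspace_sum W(1) insert.prems(2)) auto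
  ultimately show ?case using I by simp
qed

text \<open>The signs follow the given triple, so \<open>x\<close> lowers weights by 2 and
  \<open>y\<close> raises them. The last assumption says that \<open>h\<close> is diagonalisable on
  \<open>S\<close> with integer weights of absolute value at most \<open>B\<close>; it provides the
  finiteness, since the ambient type may be infinite-dimensional.\<close>

locale sl2_module =
  fixes x h y :: "'b::real_vector \<Rightarrow> 'b" and S :: "'b set" and B :: nat
  assumes linear_x: "linear x" and linear_h: "linear h" and linear_y: "linear y"
    and hx: "h (x v) - x (h v) = (-2) *\<^sub>R x v"
    and hy: "h (y v) - y (h v) = 2 *\<^sub>R y v"
    and yx: "y (x v) - x (y v) = h v"
    and subspace_S: "subspace S"
    and invariant_S: "v \<in> S \<Longrightarrow> x v \<in> S \<and> h v \<in> S \<and> y v \<in> S"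
    and weights_S: "v \<in> S \<Longrightarrow> \<exists>c. v = (\<Sum>w\<in>real_of_int ` {-int B..int B}. c w) \<and>
          (\<forall>w\<in>real_of_int ` {-int B..int B}. c w \<in> S \<and> h (c w) = w *\<^sub>R c w)"
begin

abbreviation weights :: "real set" where "weights \<equiv> real_of_int ` {-int B..int B}"

definition submodule :: "'b set \<Rightarrow> bool" where
  "submodule U \<longleftrightarrow> subspace U \<and> (\<forall>v\<in>U. x v \<in> U \<and> h v \<in> U \<and> y v \<in> U)"

definition irreducible :: "'b set \<Rightarrow> bool" where
  "irreducible U \<longleftrightarrow> submodule U \<and> U \<noteq> {0} \<and>
     (\<forall>W. submodule W \<and> W \<subseteq> U \<longrightarrow> W = {0} \<or> W = U)"

text \<open>Both extreme weight vectors are recorded, which makes the notion symmetric under the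
  exchange of \<open>x\<close> and \<open>y\<close> in \<open>dual\<close>.\<close>

definition irreducible_of_highest_weight :: "nat \<Rightarrow> 'b set \<Rightarrow> bool" where
  "irreducible_of_highest_weight n U \<longleftrightarrow> irreducible U \<and> dim U = n + 1 \<and>
     (\<exists>u\<in>U. u \<noteq> 0 \<and> x u = 0 \<and> h u = (- real n) *\<^sub>R u) \<and>
     (\<exists>u\<in>U. u \<noteq> 0 \<and> y u = 0 \<and> h u = real n *\<^sub>R u)"

sublocale x: linear x by (rule linear_x)
sublocale h: linear h by (rule linear_h)
sublocale y: linear y by (rule linear_y)

text \<open>The involution of sl(2) that exchanges \<open>x\<close> and \<open>y\<close> and negates
  \<open>h\<close>. The weight interval is symmetric about 0, so the same \<open>B\<close>
  serves.\<close>

lemma dual: "sl2_module y (\<lambda>v. - h v) x S B"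
proof (rule sl2_module.intro)
  fix v
  show "linear (\<lambda>v. - h v)" by (rule linear_compose_neg) (rule linear_h)
  show "- h (y v) - y (- h v) = (- 2) *\<^sub>R y v"
    using hy[of v] by (simp add: y.neg algebra_simps)
  show "- h (x v) - x (- h v) = 2 *\<^sub>R x v"
    using hx[of v] by (simp add: x.neg algebra_simps)
  show "x (y v) - y (x v) = - h v" using yx[of v] by (simp add: algebra_simps)
  show "y v \<in> S \<and> - h v \<in> S \<and> x v \<in> S" if "v \<in> S"
    using invariant_S[OF that] subspace_S by (simp add: subspace_neg)
  show "\<exists>c. v = (\<Sum>w\<in>weights. c w) \<and> (\<forall>w\<in>weights. c w \<in> S \<and> - h (c w) = w *\<^sub>R c w)"
    if v: "v \<in> S"
  proof -
    obtain c where c: "v = (\<Sum>w\<in>weights. c w)" "\<forall>w\<in>weights. c w \<in> S \<and> h (c w) = w *\<^sub>R c w"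
      using weights_S[OF v] by blast
    have neg: "- w \<in> weights" if "w \<in> weights" for w
    proof -
      from that obtain i where "w = real_of_int i" "i \<in> {-int B..int B}" by auto
      then have "- w = real_of_int (- i)" "- i \<in> {-int B..int B}" by auto
      then show ?thesis by blast
    qed
    have "(\<Sum>w\<in>weights. c w) = (\<Sum>w\<in>weights. c (- w))"
      by (rule sum.reindex_bij_witness[of _ uminus uminus]) (simp_all only: minus_minus neg)
    moreover have "c (- w) \<in> S \<and> - h (c (- w)) = w *\<^sub>R c (- w)" if "w \<in> weights" for w
      using bspec[OF c(2) neg[OF that]] by simp
    ultimately show ?thesis using c(1) by (intro exI[of _ "\<lambda>w. c (- w)"] conjI ballI) simp_all
  qed
qed (use linear_x linear_y subspace_S in auto)

lemma dual_submodule: "sl2_module.submodule y (\<lambda>v. - h v) x = submodule"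
  unfolding sl2_module.submodule_def[OF dual] submodule_def fun_eq_iff
  by (metis minus_minus subspace_neg)

lemma dual_irreducible: "sl2_module.irreducible y (\<lambda>v. - h v) x = irreducible"
  unfolding sl2_module.irreducible_def[OF dual] irreducible_def dual_submodule ..

lemma dual_irreducible_of_highest_weight:
  "sl2_module.irreducible_of_highest_weight y (\<lambda>v. - h v) x = irreducible_of_highest_weight"
proof -
  have "(- h u = (- a) *\<^sub>R u) = (h u = a *\<^sub>R u)" "(- h u = a *\<^sub>R u) = (h u = (- a) *\<^sub>R u)" for u a
    by (metis minus_minus scaleR_minus_left)+
  then show ?thesis
    unfolding sl2_module.irreducible_of_highest_weight_def[OF dual]
      irreducible_of_highest_weight_def dual_irreducible fun_eq_iff by auto
qed

lemma submodule_S: "submodule S"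
  using subspace_S invariant_S by (auto simp: submodule_def)

lemma submodule_funpow:
  assumes "submodule U" "v \<in> U"
  shows "(x ^^ i) v \<in> U" "(y ^^ i) v \<in> U"
  using assms by (induction i) (auto simp: submodule_def)

lemma submodule_span_weight_vectors:
  assumes U: "submodule U" "U \<subseteq> S" and "v \<in> U"
  shows "v \<in> span {u \<in> U. \<exists>w. h u = real_of_int w *\<^sub>R u}"
proof -
  obtain c where c: "v = (\<Sum>w\<in>weights. c w)" "\<forall>w\<in>weights. c w \<in> S \<and> h (c w) = w *\<^sub>R c w"
    using weights_S[of v] assms by blast
  have "\<forall>w\<in>weights. c w \<in> U"
    using U c \<open>v \<in> U\<close> by (intro weight_components[OF linear_h]) (auto simp: submodule_def)
  then show ?thesis
    unfolding c(1) using c(2) by (intro span_sum span_base) auto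
qed

lemma weight_bound:
  assumes "v \<in> S" "v \<noteq> 0" "h v = w *\<^sub>R v"
  shows "\<bar>w\<bar> \<le> real B"
proof (rule ccontr)
  assume "\<not> ?thesis"
  then have notin: "w \<notin> weights" by auto
  obtain c where c: "v = (\<Sum>w\<in>weights. c w)" "\<forall>w\<in>weights. c w \<in> S \<and> h (c w) = w *\<^sub>R c w"
    using weights_S[OF \<open>v \<in> S\<close>] by blast
  \<comment> \<open>Placing \<open>- v\<close> at the extra weight \<open>w\<close> makes the
    components sum to 0, so \<open>weight_components\<close> for \<open>{0}\<close> forces
    \<open>v = 0\<close>.\<close>
  let ?d = "c(w := - v)"
  have "(\<Sum>u\<in>insert w weights. ?d u) = - v + (\<Sum>u\<in>weights. c u)"
    using notin by (subst sum.insert) (auto intro!: sum.cong)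
  then have "(\<Sum>u\<in>insert w weights. ?d u) \<in> {0}"
    using c(1) by simp
  then have "\<forall>u\<in>insert w weights. ?d u \<in> {0}"
    by (intro weight_components[OF linear_h]) (use c(2) assms(3) notin in \<open>auto simp: subspace_0 h.neg\<close>)
  then show False using assms(2) by auto
qed

lemma weight_x_funpow:
  assumes "h v = w *\<^sub>R v"
  shows "h ((x ^^ i) v) = (w - 2 * real i) *\<^sub>R (x ^^ i) v"
proof (induction i)
  case (Suc i)
  let ?v = "(x ^^ i) v"
  have "h (x ?v) = x (h ?v) + (-2) *\<^sub>R x ?v" using hx[of ?v] by (simp add: algebra_simps)
  also have "x (h ?v) = (w - 2 * real i) *\<^sub>R x ?v" by (simp add: Suc.IH x.scale)
  finally show ?case by (simp add: algebra_simps)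
qed (use assms in simp)

text \<open>Applying \<open>x\<close> exactly \<open>B + 1\<close> times lowers a weight by 2B + 2,
  more than the length 2B of the interval of possible weights; weight vectors span
  \<open>S\<close>.\<close>

lemma nilpotent_x:
  assumes "v \<in> S"
  shows "(x ^^ Suc B) v = 0"
proof -
  have lin: "linear (x ^^ i)" for i
    proof (induction i)
    case (Suc i)
    then show ?case using linear_compose[OF Suc linear_x] by (simp add: o_def)
  qed (simp add: linear_id[unfolded id_def])
  have "(x ^^ Suc B) u = 0" if "u \<in> S" "h u = w *\<^sub>R u" for u w
  proof (rule ccontr)
    assume nz: "(x ^^ Suc B) u \<noteq> 0"
    then have "u \<noteq> 0" using linear_0[OF lin] by metis
    then have "\<bar>w\<bar> \<le> real B" using that weight_bound by blast
    moreover have "\<bar>w - 2 * real (Suc B)\<bar> \<le> real B"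
      using nz submodule_funpow(1)[OF submodule_S \<open>u \<in> S\<close>] weight_x_funpow[OF that(2)]
      by (intro weight_bound) blast+
    ultimately show False by auto
  qed
  then have "span {u \<in> S. \<exists>w. h u = real_of_int w *\<^sub>R u} \<subseteq> {v. (x ^^ Suc B) v = 0}"
    by (intro span_minimal linear_subspace_kernel lin) (auto simp del: funpow.simps)
  then show ?thesis
    using submodule_span_weight_vectors[OF submodule_S subset_refl assms] by (rule subsetD[THEN CollectD])
qed

lemma weight_y_funpow:
  assumes "h u = (- c) *\<^sub>R u"
  shows "h ((y ^^ i) u) = (2 * real i - c) *\<^sub>R (y ^^ i) u"
  using sl2_module.weight_x_funpow[OF dual, of u c i] assms
  by (metis (no_types, opaque_lifting) minus_diff_eq minus_equation_iff scaleR_minus_left)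

text \<open>Moving \<open>x\<close> to the right past one \<open>y\<close> at a time costs
  \<open>- h\<close> each time, so the coefficient is the sum of c - 2j over j = 0, ..., i.\<close>

lemma x_y_funpow:
  assumes "x u = 0" "h u = (- c) *\<^sub>R u"
  shows "x ((y ^^ Suc i) u) = ((real i + 1) * (c - real i)) *\<^sub>R (y ^^ i) u"
proof (induction i)
  case 0
  then show ?case using yx[of u] assms by (simp add: algebra_simps)
next
  case (Suc i)
  let ?v = "(y ^^ Suc i) u"
  have "x (y ?v) = y (x ?v) - h ?v"
    using yx[of ?v] by (simp add: algebra_simps)
  also have "y (x ?v) = ((real i + 1) * (c - real i)) *\<^sub>R ?v"
    by (simp only: Suc.IH y.scale) simp
  also have "h ?v = (2 * real (Suc i) - c) *\<^sub>R ?v"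
    by (rule weight_y_funpow) fact
  finally show ?case
    by (simp add: scaleR_left_diff_distrib[symmetric] del: funpow.simps)
       (simp add: algebra_simps)
qed

text \<open>The string of \<open>y\<close> stops because \<open>y\<close> is nilpotent. At its last
  nonzero vector the coefficient (n + 1)(c - n) of \<open>x_y_funpow\<close> must vanish, which
  forces c = n.\<close>

lemma lowest_weight_nat:
  assumes "u \<in> S" "u \<noteq> 0" "x u = 0" "h u = (- c) *\<^sub>R u"
  obtains n where "c = real n" "\<And>i. i \<le> n \<Longrightarrow> (y ^^ i) u \<noteq> 0" "(y ^^ Suc n) u = 0"
proof -
  have "(y ^^ Suc B) u = 0"
    using sl2_module.nilpotent_x[OF dual] assms(1) by blast
  define N where "N = (LEAST N. (y ^^ N) u = 0)"
  have N: "(y ^^ N) u = 0" and less: "\<And>i. i < N \<Longrightarrow> (y ^^ i) u \<noteq> 0"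
    using LeastI[of "\<lambda>N. (y ^^ N) u = 0", OF \<open>(y ^^ Suc B) u = 0\<close>] not_less_Least[of _ "\<lambda>N. (y ^^ N) u = 0"]
    by (auto simp: N_def)
  have "N \<noteq> 0" using N assms(2) by (metis funpow_0)
  then obtain n where n: "N = Suc n" using not0_implies_Suc by blast
  have "((real n + 1) * (c - real n)) *\<^sub>R (y ^^ n) u = 0"
    unfolding x_y_funpow[OF assms(3,4), symmetric] using N by (simp only: n x.zero)
  then have "c = real n" using less[of n] n by simp
  moreover have "(y ^^ i) u \<noteq> 0" if "i \<le> n" for i using less[of i] n that by simp
  ultimately show ?thesis using that[of n] N unfolding n by blast
qed

text \<open>The vectors of a string have pairwise distinct weights 2i - n, so an
  \<open>h\<close>-stable subspace containing a combination contains each of its terms.\<close>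

lemma string_independent:
  assumes u: "x u = 0" "h u = (- real n) *\<^sub>R u" and nz: "\<And>i. i \<le> n \<Longrightarrow> (y ^^ i) u \<noteq> 0"
    and W: "subspace W" "\<And>v. v \<in> W \<Longrightarrow> h v \<in> W"
    and "(\<Sum>i\<le>n. a i *\<^sub>R (y ^^ i) u) \<in> W" "i \<le> n" "a i \<noteq> 0"
  shows "(y ^^ i) u \<in> W"
proof -
  let ?w = "\<lambda>i. 2 * real i - real n"
  \<comment> \<open>\<open>weight_components\<close> indexes components by their weight, so
    positions in the string are recovered through the inverse of i -> 2i - n.\<close>
  define v where "v w = (let i = inv_into {..n} ?w w in a i *\<^sub>R (y ^^ i) u)" for w
  have inj: "inj_on ?w {..n}" by (auto simp: inj_on_def)
  have v: "v (?w i) = a i *\<^sub>R (y ^^ i) u" if "i \<le> n" for i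
    using inv_into_f_f[OF inj, of i] that by (simp add: v_def)
  have "\<forall>w\<in>?w ` {..n}. v w \<in> W"
  proof (rule weight_components[OF linear_h W])
    show "h (v w) = w *\<^sub>R v w" if "w \<in> ?w ` {..n}" for w
      using that weight_y_funpow[OF u(2)] by (auto simp: v h.scale)
    show "(\<Sum>w\<in>?w ` {..n}. v w) \<in> W"
      by (subst sum.reindex[OF inj]) (use assms(6) in \<open>simp add: v\<close>)
  qed auto
  then have "a i *\<^sub>R (y ^^ i) u \<in> W" using v \<open>i \<le> n\<close> by auto
  then show ?thesis using subspace_scaleR_cancel W(1) \<open>a i \<noteq> 0\<close> by blast
qed

lemma string_inj_independent:
  assumes u: "x u = 0" "h u = (- real n) *\<^sub>R u" and nz: "\<And>i. i \<le> n \<Longrightarrow> (y ^^ i) u \<noteq> 0"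
  shows "inj_on (\<lambda>i. (y ^^ i) u) {..n}" "independent ((\<lambda>i. (y ^^ i) u) ` {..n})"
proof -
  show inj: "inj_on (\<lambda>i. (y ^^ i) u) {..n}"
  proof (rule inj_onI)
    fix i j assume ij: "i \<in> {..n}" "j \<in> {..n}" "(y ^^ i) u = (y ^^ j) u"
    then have "(2 * real i - real n) *\<^sub>R (y ^^ i) u = (2 * real j - real n) *\<^sub>R (y ^^ i) u"
      using weight_y_funpow[OF u(2), of i] weight_y_funpow[OF u(2), of j] by metis
    moreover have "(y ^^ i) u \<noteq> 0" using nz[of i] ij(1) by simp
    ultimately have "2 * real i - real n = 2 * real j - real n"
      unfolding scaleR_cancel_right by blast
    then show "i = j" by simp
  qed
  show "independent ((\<lambda>i. (y ^^ i) u) ` {..n})"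
    unfolding independent_explicit_finite_subsets
  proof (intro allI impI)
    fix A c assume A: "A \<subseteq> (\<lambda>i. (y ^^ i) u) ` {..n}" "finite A" "(\<Sum>v\<in>A. c v *\<^sub>R v) = 0"
    define a where "a i = (if (y ^^ i) u \<in> A then c ((y ^^ i) u) else 0)" for i
    have "(\<Sum>i\<le>n. a i *\<^sub>R (y ^^ i) u) = (\<Sum>v\<in>(\<lambda>i. (y ^^ i) u) ` {..n}. if v \<in> A then c v *\<^sub>R v else 0)"
      by (subst sum.reindex[OF inj]) (auto simp: a_def intro!: sum.cong)
    also have "\<dots> = (\<Sum>v\<in>A. c v *\<^sub>R v)"
      by (rule sum.mono_neutral_cong_right) (use A in auto)
    finally have "(\<Sum>i\<le>n. a i *\<^sub>R (y ^^ i) u) \<in> {0}" using A by simp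
    then have "a i = 0" if "i \<le> n" for i
      using string_independent[OF u nz, of "{0}" a i] nz[of i] that by (auto simp: subspace_0)
    then show "\<forall>v\<in>A. c v = 0" using A(1) by (force simp: a_def)
  qed
qed

text \<open>A nonzero submodule of the string contains some \<open>(y ^^ i) u\<close> by
  \<open>string_independent\<close>. The coefficients (j + 1)(n - j) are nonzero for j < n, so
  \<open>x\<close> leads down to \<open>u\<close>, and \<open>y\<close> then recovers the whole
  string.\<close>

lemma string_irreducible:
  assumes u: "u \<in> S" "x u = 0" "h u = (- real n) *\<^sub>R u" and nz: "\<And>i. i \<le> n \<Longrightarrow> (y ^^ i) u \<noteq> 0"
    and end_: "(y ^^ Suc n) u = 0"
  defines "U \<equiv> span ((\<lambda>i. (y ^^ i) u) ` {..n})"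
  shows "irreducible_of_highest_weight n U"
proof -
  have low: "u \<in> U" "u \<noteq> 0" and high: "(y ^^ n) u \<in> U" "(y ^^ n) u \<noteq> 0" "y ((y ^^ n) u) = 0"
    using nz[of 0] nz[of n] end_ span_base[OF imageI[of 0 "{..n}" "\<lambda>i. (y ^^ i) u"]]
    by (auto simp: U_def intro!: span_base)
  have "h ((y ^^ n) u) = real n *\<^sub>R (y ^^ n) u" using weight_y_funpow[OF u(3), of n] by simp
  note ends = low high this
  have dim: "dim U = n + 1"
    unfolding U_def using string_inj_independent[OF u(2,3) nz]
    by (simp add: dim_span dim_eq_card_independent card_image)
  have in_U: "(y ^^ i) u \<in> U" for i
  proof (cases "i \<le> n")
    case False
    have "(y ^^ (Suc n + j)) u = 0" for j
      by (induction j) (use end_ in auto)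
    then have "(y ^^ i) u = 0" using False by (metis le_add_diff_inverse not_less_eq_eq)
    then show ?thesis by (simp add: U_def span_zero)
  qed (auto simp: U_def intro: span_base)
  have "g v \<in> U" if "v \<in> U" "linear g" "\<And>i. i \<le> n \<Longrightarrow> g ((y ^^ i) u) \<in> U" for g v
  proof -
    have "g v \<in> span (g ` (\<lambda>i. (y ^^ i) u) ` {..n})"
      using that(1) linear_span_image[OF that(2)] by (auto simp: U_def)
    also have "\<dots> \<subseteq> U" using that(3) by (intro span_minimal) (auto simp: U_def)
    finally show ?thesis .
  qed
  moreover have "x ((y ^^ i) u) \<in> U" for i
    using x_y_funpow[OF u(2,3)] in_U u(2) by (cases i) (auto simp: U_def span_scale span_zero simp del: funpow.simps)
  moreover have "h ((y ^^ i) u) \<in> U" "y ((y ^^ i) u) \<in> U" for i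
    using weight_y_funpow[OF u(3)] in_U[of i] in_U[of "Suc i"] by (auto simp: U_def span_scale)
  ultimately have sub: "submodule U"
    using linear_x linear_h linear_y by (auto simp: submodule_def U_def)
  moreover have "U \<noteq> {0}" using in_U[of 0] nz[of 0] by auto
  moreover have "W = {0} \<or> W = U" if W: "submodule W" "W \<subseteq> U" for W
  proof (rule disjCI)
    assume "W \<noteq> U"
    show "W = {0}"
    proof (rule ccontr)
      assume "W \<noteq> {0}"
      then obtain v where v: "v \<in> W" "v \<noteq> 0"
        using W(1) by (auto simp: submodule_def dest: subspace_0)
      obtain c where c: "v = (\<Sum>s\<in>(\<lambda>i. (y ^^ i) u) ` {..n}. c s *\<^sub>R s)"
        using v W(2) by (auto simp: U_def span_finite)
      then have c: "v = (\<Sum>i\<le>n. c ((y ^^ i) u) *\<^sub>R (y ^^ i) u)"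
        by (subst (asm) sum.reindex[OF string_inj_independent(1)[OF u(2,3) nz]]) auto
      then obtain i where i: "i \<le> n" "c ((y ^^ i) u) \<noteq> 0"
        using v(2) by (metis (no_types, lifting) atMost_iff scale_eq_0_iff sum.neutral)
      have "(y ^^ i) u \<in> W"
        using W i v(1) by (intro string_independent[OF u(2,3) nz, of W "\<lambda>i. c ((y ^^ i) u)"])
          (auto simp: submodule_def c)
      then have "u \<in> W" using i(1)
      proof (induction i)
        case (Suc i)
        let ?c = "(real i + 1) * (real n - real i)"
        have "x ((y ^^ Suc i) u) \<in> W"
          using Suc.prems(1) W(1) by (auto simp: submodule_def)
        then have "?c *\<^sub>R (y ^^ i) u \<in> W"
          unfolding x_y_funpow[OF u(2,3)] .
        moreover have "subspace W" using W(1) by (simp add: submodule_def)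
        moreover have "?c \<noteq> 0" using Suc.prems(2) by auto
        ultimately have "(y ^^ i) u \<in> W" using subspace_scaleR_cancel by blast
        then show ?case using Suc by auto
      qed simp
      then have "U \<subseteq> W"
        using W(1) submodule_funpow(2)[OF W(1)] unfolding U_def
        by (intro span_minimal) (auto simp: submodule_def)
      then show False using W(2) \<open>W \<noteq> U\<close> by auto
    qed
  qed
  ultimately have "irreducible U" by (simp add: irreducible_def)
  then show ?thesis
    unfolding irreducible_of_highest_weight_def using dim ends u(2,3)
    by (intro conjI bexI[of _ u] bexI[of _ "(y ^^ n) u"]) simp_all
qed

text \<open>Powers of \<open>x\<close> push \<open>v\<close> down to a lowest weight vector of
  weight w - 2N = -n. Its string gives n + 1 independent vectors in \<open>U\<close>, so n <= m, and
  w >= -n.\<close>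

lemma weight_ge_dim:
  assumes U: "submodule U" "U \<subseteq> S" "dim U = Suc m" and v: "v \<in> U" "v \<noteq> 0" "h v = w *\<^sub>R v"
  shows "- real m \<le> w"
proof -
  define N where "N = (LEAST N. (x ^^ Suc N) v = 0)"
  have "(x ^^ Suc N) v = 0"
    unfolding N_def by (rule LeastI[of "\<lambda>N. (x ^^ Suc N) v = 0" B], rule nilpotent_x) (use U(2) v(1) in blast)
  have "(x ^^ N) v \<noteq> 0"
  proof (cases N)
    case (Suc M)
    then have "M < (LEAST N. (x ^^ Suc N) v = 0)" unfolding N_def[symmetric] by simp
    then show ?thesis using not_less_Least unfolding Suc by blast
  qed (use v(2) in simp)
  define u where "u = (x ^^ N) v"
  have u: "u \<in> U" "u \<noteq> 0" "x u = 0" "h u = (- (2 * real N - w)) *\<^sub>R u"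
    using submodule_funpow(1)[OF U(1) v(1), of N] weight_x_funpow[OF v(3), of N]
      \<open>(x ^^ N) v \<noteq> 0\<close> \<open>(x ^^ Suc N) v = 0\<close> by (simp_all add: u_def)
  obtain n where n: "2 * real N - w = real n" "\<And>i. i \<le> n \<Longrightarrow> (y ^^ i) u \<noteq> 0"
    using lowest_weight_nat[OF _ u(2-4)] u(1) U(2) by blast
  note indep = string_inj_independent[OF u(3) u(4)[unfolded n(1)] n(2)]
  obtain b where b: "b \<subseteq> U" "independent b" "U \<subseteq> span b" "card b = dim U"
    using basis_exists by blast
  \<comment> \<open>An infinite basis would have cardinality 0 in this logic, whereas the dimension
    is a successor.\<close>
  have "finite b" using b(4) U(3) by (metis card.infinite nat.distinct(1))
  moreover have "(\<lambda>i. (y ^^ i) u) ` {..n} \<subseteq> span b"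
    using b(3) submodule_funpow(2)[OF U(1) u(1)] by blast
  ultimately have "card ((\<lambda>i. (y ^^ i) u) ` {..n}) \<le> card b"
    using independent_span_bound indep(2) by blast
  then have "n \<le> m" using card_image[OF indep(1)] b(4) U(3) by simp
  then show ?thesis using n(1) by linarith
qed

lemma weight_le_dim:
  assumes U: "submodule U" "U \<subseteq> S" "dim U = Suc m" and v: "v \<in> U" "v \<noteq> 0" "h v = w *\<^sub>R v"
  shows "\<bar>w\<bar> \<le> real m"
proof -
  have "- real m \<le> - w"
    by (rule sl2_module.weight_ge_dim[OF dual, of U m v]) (use assms dual_submodule in auto)
  then show ?thesis using weight_ge_dim[OF assms] by linarith
qed

text \<open>The core of complete reducibility. By induction \<open>x v\<close> is a combination of
  string vectors of weight w - 2. Since w - 2 is negative, none of them is the top of its string, so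
  each is the image under \<open>x\<close> of a multiple of its successor. This yields v' of weight
  w with \<open>x v' = x v\<close>, and \<open>v - v'\<close> is killed by \<open>x\<close>, hence
  zero or itself the start of a string.\<close>

lemma nonpos_weight_in_span_strings:
  fixes w :: int
  assumes M: "submodule M" "M \<subseteq> S" and "v \<in> M" "h v = real_of_int w *\<^sub>R v" "w \<le> 0"
  shows "v \<in> span {(y ^^ i) u | u n i. u \<in> M \<and> u \<noteq> 0 \<and> x u = 0 \<and> h u = (- real n) *\<^sub>R u \<and>
           i \<le> n \<and> 2 * int i - int n = w}" (is "_ \<in> span (?G w)")
  using assms(3-)
proof (induction "nat (w + int B)" arbitrary: v w rule: less_induct)
  case less
  have M': "subspace M" "\<And>v. v \<in> M \<Longrightarrow> x v \<in> M" using M(1) by (auto simp: submodule_def)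
  have lowest: "u \<in> span (?G w)" if "u \<in> M" "x u = 0" "h u = real_of_int w *\<^sub>R u" for u
  proof (cases "u = 0")
    case False
    then have "u \<in> ?G w" using that less.prems(3)
      by (intro CollectI exI[of _ u] exI[of _ "nat (- w)"] exI[of _ "0::nat"]) auto
    then show ?thesis by (rule span_base)
  qed (simp add: span_zero)
  show ?case
  proof (cases "x v = 0")
    case True
    then show ?thesis using lowest less.prems by blast
  next
    case False
    have wt: "h (x v) = real_of_int (w - 2) *\<^sub>R x v"
      using weight_x_funpow[OF less.prems(2), of 1] by simp
    then have "\<bar>real_of_int (w - 2)\<bar> \<le> real B"
      using False M' M(2) less.prems(1) by (intro weight_bound) auto
    \<comment> \<open>The weight bound for the nonzero vector \<open>x v\<close> keeps w - 2 + B
      nonnegative, so \<open>nat\<close> does not truncate and the measure really drops.\<close>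
    then have "nat (w - 2 + int B) < nat (w + int B)" by linarith
    then have "x v \<in> span (?G (w - 2))"
      using less.hyps[of "w - 2" "x v"] wt M' less.prems by auto
    also have "\<dots> \<subseteq> x ` span (?G w)"
    proof (intro span_minimal linear_subspace_image linear_x subspace_span subsetI)
      fix g assume "g \<in> ?G (w - 2)"
      then obtain u n i where g: "g = (y ^^ i) u" and u: "u \<in> M" "u \<noteq> 0" "x u = 0" "h u = (- real n) *\<^sub>R u"
        and i: "i \<le> n" "2 * int i - int n = w - 2" by blast
      let ?c = "(real i + 1) * (real n - real i)"
      have "i < n" using i less.prems(3) by linarith
      then have "?c \<noteq> 0" by auto
      have "(y ^^ Suc i) u \<in> ?G w"
        using u i \<open>i < n\<close> by (intro CollectI exI[of _ u] exI[of _ n] exI[of _ "Suc i"]) auto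
      then have "inverse ?c *\<^sub>R (y ^^ Suc i) u \<in> span (?G w)"
        by (intro span_scale span_base)
      moreover have "x (inverse ?c *\<^sub>R (y ^^ Suc i) u) = g"
        unfolding x.scale x_y_funpow[OF u(3,4)] g scaleR_scaleR left_inverse[OF \<open>?c \<noteq> 0\<close>] by simp
      ultimately show "g \<in> x ` span (?G w)" by (rule image_eqI[OF sym, rotated])
    qed
    finally obtain v' where v': "v' \<in> span (?G w)" "x v = x v'" by blast
    have "?G w \<subseteq> {u \<in> M. h u = real_of_int w *\<^sub>R u}"
    proof
      fix g assume "g \<in> ?G w"
      then obtain u n i where g: "g = (y ^^ i) u" and u: "u \<in> M" "h u = (- real n) *\<^sub>R u"
        and i: "2 * int i - int n = w" by blast
      have "2 * real i - real n = real_of_int w" using i by linarith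
      then show "g \<in> {u \<in> M. h u = real_of_int w *\<^sub>R u}"
        using g submodule_funpow(2)[OF M(1) u(1)] weight_y_funpow[OF u(2), of i] by auto
    qed
    moreover have "subspace {u \<in> M. h u = real_of_int w *\<^sub>R u}"
      using M'(1) by (auto simp: subspace_def h.add h.scale algebra_simps)
    ultimately have "v' \<in> {u \<in> M. h u = real_of_int w *\<^sub>R u}"
      using v'(1) span_minimal by blast
    then have "v - v' \<in> span (?G w)"
      using less.prems v'(2) M'(1)
      by (intro lowest) (auto simp: x.diff h.diff subspace_diff algebra_simps)
    then show ?thesis using span_add[OF _ v'(1)] by fastforce
  qed
qed

lemma nonpos_weight_in_span_irreducibles:
  fixes w :: int
  assumes M: "submodule M" "M \<subseteq> S" and v: "v \<in> M" "h v = real_of_int w *\<^sub>R v" "w \<le> 0"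
  shows "v \<in> span (\<Union>{U. U \<subseteq> M \<and> (\<exists>n. irreducible_of_highest_weight n U)})"
proof -
  have M': "subspace M" "M \<subseteq> S" using M by (auto simp: submodule_def)
  have "(y ^^ i) u \<in> \<Union>{U. U \<subseteq> M \<and> (\<exists>n. irreducible_of_highest_weight n U)}"
    if u: "u \<in> M" "u \<noteq> 0" "x u = 0" "h u = (- real n) *\<^sub>R u" and "i \<le> n" for u n i
  proof -
    obtain n' where n': "real n = real n'" "\<And>i. i \<le> n' \<Longrightarrow> (y ^^ i) u \<noteq> 0" "(y ^^ Suc n') u = 0"
      using lowest_weight_nat[OF _ u(2-4)] u(1) M(2) by blast
    then have "n' = n" by simp
    let ?U = "span ((\<lambda>i. (y ^^ i) u) ` {..n})"
    have "irreducible_of_highest_weight n ?U"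
      using string_irreducible[of u n] u n' M(2) unfolding \<open>n' = n\<close> by blast
    moreover have "?U \<subseteq> M"
      using submodule_funpow(2)[OF M(1) u(1)] M'(1) by (intro span_minimal) auto
    moreover have "(y ^^ i) u \<in> ?U" using \<open>i \<le> n\<close> by (intro span_base) auto
    ultimately show ?thesis by blast
  qed
  then show ?thesis
    using nonpos_weight_in_span_strings[OF assms]
    by (elim subsetD[OF span_mono, rotated]) blast
qed

text \<open>Positive weights become negative in the dual module, which has the same submodules and
  the same irreducible ones, so the nonpositive case covers both halves.\<close>

lemma submodule_subset_span_irreducibles:
  assumes M: "submodule M" "M \<subseteq> S"
  shows "M \<subseteq> span (\<Union>{U. U \<subseteq> M \<and> (\<exists>n. irreducible_of_highest_weight n U)})" (is "_ \<subseteq> span ?I")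
proof
  fix v assume "v \<in> M"
  have "u \<in> span ?I" if u: "u \<in> M" "h u = real_of_int w *\<^sub>R u" for u w
  proof (cases "w \<le> 0")
    case True
    then show ?thesis using nonpos_weight_in_span_irreducibles[OF M u] by blast
  next
    case False
    then show ?thesis
      using sl2_module.nonpos_weight_in_span_irreducibles[OF dual, of M u "- w"] M u
      unfolding dual_submodule dual_irreducible_of_highest_weight by simp
  qed
  then have "{u \<in> M. \<exists>w. h u = real_of_int w *\<^sub>R u} \<subseteq> span ?I" by blast
  then show "v \<in> span ?I"
    using submodule_span_weight_vectors[OF M \<open>v \<in> M\<close>] span_minimal[OF _ subspace_span] by blast
qed

end

section \<open>Exponential curves\<close>

text \<open>Nilpotency along \<open>v\<close> turns the exponential series into a polynomial in
  \<open>t\<close>, so the curve can be differentiated term by term without convergence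
  arguments.\<close>

lemma exp_curve_nilpotent:
  fixes A :: "'v::euclidean_space \<Rightarrow>\<^sub>L 'v"
  assumes "(blinfun_apply A ^^ N) v = 0"
  shows "exp_curve A v t = (\<Sum>j<N. (t ^ j / fact j) *\<^sub>R (blinfun_apply A ^^ j) v)"
proof -
  have "(blinfun_apply A ^^ (N + i)) v = 0" for i
    by (induction i) (use assms in \<open>auto simp: blinfun.zero_right\<close>)
  then have "(blinfun_apply A ^^ j) v = 0" if "j \<notin> {..<N}" for j
    using that by (metis le_add_diff_inverse lessThan_iff not_less)
  then show ?thesis unfolding exp_curve_def by (subst suminf_finite[of "{..<N}"]) auto
qed

lemma exp_curve_0:
  fixes A :: "'v::euclidean_space \<Rightarrow>\<^sub>L 'v"
  assumes "(blinfun_apply A ^^ N) v = 0"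
  shows "exp_curve A v 0 = v"
proof -
  have "exp_curve A v 0 = (\<Sum>j<Suc N. (0 ^ j / fact j) *\<^sub>R (blinfun_apply A ^^ j) v)"
    using assms by (intro exp_curve_nilpotent) (simp add: blinfun.zero_right)
  also have "\<dots> = v" by (subst sum.lessThan_Suc_shift) simp
  finally show ?thesis .
qed

lemma exp_curve_commute:
  fixes A :: "'v::euclidean_space \<Rightarrow>\<^sub>L 'v"
  assumes "(blinfun_apply A ^^ N) v = 0"
  shows "exp_curve A (A v) t = A (exp_curve A v t)"
proof -
  have "(blinfun_apply A ^^ N) (A v) = 0"
    using assms by (simp add: funpow_swap1[symmetric] blinfun.zero_right)
  then show ?thesis
    by (simp add: exp_curve_nilpotent[OF assms] exp_curve_nilpotent[where N = N and v = "A v"] blinfun.sum_right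
        blinfun.scaleR_right funpow_swap1)
qed

lemma has_vector_derivative_exp_curve:
  fixes A :: "'v::euclidean_space \<Rightarrow>\<^sub>L 'v"
  assumes "(blinfun_apply A ^^ N) v = 0"
  shows "(exp_curve A v has_vector_derivative exp_curve A (A v) t) (at t)"
proof -
  have A: "(blinfun_apply A ^^ N) (A v) = 0" "(blinfun_apply A ^^ Suc N) v = 0"
    using assms by (simp_all add: funpow_swap1[symmetric] blinfun.zero_right)
  let ?D = "\<lambda>j. (real j * t ^ (j - 1) / fact j) *\<^sub>R (blinfun_apply A ^^ j) v"
  have "((\<lambda>t. \<Sum>j<Suc N. (t ^ j / fact j) *\<^sub>R (blinfun_apply A ^^ j) v)
      has_vector_derivative (\<Sum>j<Suc N. ?D j)) (at t)"
    by (intro has_vector_derivative_sum) (auto intro!: derivative_eq_intros simp: has_vector_derivative_def)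
  also have "(\<Sum>j<Suc N. ?D j) = (\<Sum>j<N. ?D (Suc j))"
    by (subst sum.lessThan_Suc_shift) simp
  also have "\<dots> = exp_curve A (A v) t"
    unfolding exp_curve_nilpotent[OF A(1)]
    by (intro sum.cong) (auto simp: funpow_swap1 fact_Suc simp del: of_nat_Suc)
  also have "(\<lambda>t. \<Sum>j<Suc N. (t ^ j / fact j) *\<^sub>R (blinfun_apply A ^^ j) v) = exp_curve A v"
    using exp_curve_nilpotent[OF A(2)] by presburger
  finally show ?thesis .
qed

text \<open>Each differentiation replaces the starting vector \<open>v\<close> by
  \<open>A v\<close>. This is what makes the osculating spaces explicit.\<close>

lemma iterated_derivative_exp_curve:
  fixes A :: "'v::euclidean_space \<Rightarrow>\<^sub>L 'v"
  assumes "(blinfun_apply A ^^ N) v = 0"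
  shows "((\<lambda>g u. vector_derivative g (at u)) ^^ j) (exp_curve A v) = exp_curve A ((blinfun_apply A ^^ j) v)"
proof (induction j)
  case (Suc j)
  have "(blinfun_apply A ^^ N) ((blinfun_apply A ^^ j) v) = (blinfun_apply A ^^ j) ((blinfun_apply A ^^ N) v)"
    by (metis add.commute comp_apply funpow_add)
  also have "\<dots> = 0" unfolding assms by (induction j) (simp_all add: blinfun.zero_right)
  finally show ?case
    using Suc.IH by (auto intro!: ext vector_derivative_at has_vector_derivative_exp_curve)
qed simp

text \<open>The product rule gives the terms (A u, D v) and (A D u, v) under the form; skewness of
  \<open>D\<close> rewrites the first as -(D A u, v), and together they are minus the
  bracket.\<close>

lemma has_vector_derivative_bilinear_exp_curve:
  fixes A D :: "'v::euclidean_space \<Rightarrow>\<^sub>L 'v" and \<sigma> :: "'v \<Rightarrow> 'v \<Rightarrow> real"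
  assumes \<sigma>: "bilinear \<sigma>" and D: "\<And>u v. \<sigma> (D u) v + \<sigma> u (D v) = 0"
    and uv: "(blinfun_apply D ^^ N) u = 0" "(blinfun_apply D ^^ N) v = 0"
  shows "((\<lambda>t. \<sigma> (A (exp_curve D u t)) (exp_curve D v t)) has_vector_derivative
      - \<sigma> (lie_bracket D A (exp_curve D u t)) (exp_curve D v t)) (at t)"
proof -
  let ?u = "exp_curve D u" and ?v = "exp_curve D v"
  have "((\<lambda>t. \<sigma> (A (?u t)) (?v t)) has_vector_derivative
      \<sigma> (A (?u t)) (exp_curve D (D v) t) + \<sigma> (A (exp_curve D (D u) t)) (?v t)) (at t)"
    by (intro bounded_bilinear.has_vector_derivative[OF \<sigma>[unfolded bilinear_conv_bounded_bilinear]]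
        has_vector_derivative_exp_curve[OF uv(1)] has_vector_derivative_exp_curve[OF uv(2)]
        bounded_linear.has_vector_derivative[OF blinfun.bounded_linear_right])
  also have "\<sigma> (A (?u t)) (exp_curve D (D v) t) + \<sigma> (A (exp_curve D (D u) t)) (?v t) =
      - \<sigma> (lie_bracket D A (?u t)) (?v t)"
    using D[of "A (?u t)" "?v t"]
    unfolding exp_curve_commute[OF uv(1)] exp_curve_commute[OF uv(2)]
    by (simp add: lie_bracket_def blinfun.diff_left bilinear_lsub[OF \<sigma>])
  finally show ?thesis .
qed

text \<open>Up to sign, the hypothesis says that all derivatives at \<open>t = 0\<close> vanish, and
  nilpotency of the bracket makes the function polynomial. The induction integrates once per step:
  zero derivative, hence constant, hence equal to the value at 0.\<close>

lemma bilinear_exp_curve_eq_0: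
  fixes A D :: "'v::euclidean_space \<Rightarrow>\<^sub>L 'v" and \<sigma> :: "'v \<Rightarrow> 'v \<Rightarrow> real"
  assumes \<sigma>: "bilinear \<sigma>" and D: "\<And>u v. \<sigma> (D u) v + \<sigma> u (D v) = 0"
    and uv: "(blinfun_apply D ^^ N) u = 0" "(blinfun_apply D ^^ N) v = 0"
    and "(lie_bracket D ^^ m) A = 0" and "\<And>i. \<sigma> ((lie_bracket D ^^ i) A u) v = 0"
  shows "\<sigma> (A (exp_curve D u t)) (exp_curve D v t) = 0"
  using assms(5,6)
proof (induction m arbitrary: A t)
  case 0
  then show ?case using bilinear_lzero[OF \<sigma>] by (simp add: blinfun.zero_left)
next
  case (Suc m)
  let ?u = "exp_curve D u" and ?v = "exp_curve D v"
  have "(lie_bracket D ^^ m) (lie_bracket D A) = 0" using Suc.prems(1) by (simp only: funpow_Suc_right comp_apply)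
  moreover have "\<sigma> ((lie_bracket D ^^ i) (lie_bracket D A) u) v = 0" for i
    using Suc.prems(2)[of "Suc i"] by (simp only: funpow_Suc_right comp_apply)
  ultimately have "\<sigma> (lie_bracket D A (?u t)) (?v t) = 0" for t
    by (rule Suc.IH)
  then have "((\<lambda>t. \<sigma> (A (?u t)) (?v t)) has_derivative (\<lambda>_. 0)) (at t within UNIV)" for t
    using has_vector_derivative_bilinear_exp_curve[OF \<sigma> D uv, of A t]
    by (simp add: has_vector_derivative_def)
  then obtain c where c: "\<And>t. \<sigma> (A (?u t)) (?v t) = c"
    using has_derivative_zero_constant[of UNIV "\<lambda>t. \<sigma> (A (?u t)) (?v t)"] by auto
  have "\<sigma> (A (?u 0)) (?v 0) = 0"
    using Suc.prems(2)[of 0] by (simp add: exp_curve_0[OF uv(1)] exp_curve_0[OF uv(2)])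
  then show ?case using c by simp
qed

lemma lie_bracket_jacobi:
  "lie_bracket A (lie_bracket B C) - lie_bracket B (lie_bracket A C) = lie_bracket (lie_bracket A B) C"
  by (rule blinfun_eqI) (simp add: lie_bracket_def blinfun.bilinear_simps algebra_simps)

lemma linear_lie_bracket: "linear (lie_bracket A)"
  by (rule linearI; rule blinfun_eqI) (simp_all add: lie_bracket_def blinfun.bilinear_simps algebra_simps)

lemma lie_bracket_scaleR_left: "lie_bracket (c *\<^sub>R A) B = c *\<^sub>R lie_bracket A B"
  by (rule blinfun_eqI) (simp add: lie_bracket_def blinfun.bilinear_simps algebra_simps)

section \<open>The sl(2)-triple on the given bases and its skewness for the symplectic form\<close>

context sl2_symplectic_space
begin

abbreviation Ve :: "'v set" where "Ve \<equiv> span (e ` {1..r})"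
abbreviation Vf :: "'v set" where "Vf \<equiv> span (f ` {1..r})"

lemmas sigma_simps = bilinear_ladd[OF \<sigma>_bilinear] bilinear_radd[OF \<sigma>_bilinear]
  bilinear_lsub[OF \<sigma>_bilinear] bilinear_rsub[OF \<sigma>_bilinear]
  bilinear_lneg[OF \<sigma>_bilinear] bilinear_rneg[OF \<sigma>_bilinear]
  bilinear_lmul[OF \<sigma>_bilinear] bilinear_rmul[OF \<sigma>_bilinear]
  bilinear_lzero[OF \<sigma>_bilinear] bilinear_rzero[OF \<sigma>_bilinear]

lemma linear_sigma: "linear (\<sigma> u)" "linear (\<lambda>u. \<sigma> u v)"
  using \<sigma>_bilinear by (auto simp: bilinear_def)

lemma linear_eq_on_basis:
  assumes "linear g" "linear g'"
    and "\<And>i. i \<in> {1..r} \<Longrightarrow> g (e i) = g' (e i)" "\<And>i. i \<in> {1..r} \<Longrightarrow> g (f i) = g' (f i)"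
  shows "g v = g' v"
proof (rule linear_eq_on_span[OF assms(1,2)])
  show "v \<in> span (e ` {1..r} \<union> f ` {1..r})" unfolding basis_span by (rule UNIV_I)
  show "g u = g' u" if "u \<in> e ` {1..r} \<union> f ` {1..r}" for u
    using that by (elim UnE imageE) (simp_all only: assms(3,4))
qed

lemma blinfun_eq_on_basis:
  fixes A B :: "'v \<Rightarrow>\<^sub>L 'v"
  assumes "\<And>i. i \<in> {1..r} \<Longrightarrow> A (e i) = B (e i)" "\<And>i. i \<in> {1..r} \<Longrightarrow> A (f i) = B (f i)"
  shows "A = B"
  using linear_eq_on_basis[OF blinfun.bounded_linear_right[THEN bounded_linear.linear]
      blinfun.bounded_linear_right[THEN bounded_linear.linear] assms]
  by (rule blinfun_eqI)

text \<open>The triple acts by the same formulas on both bases; an abstract \<open>g\<close> lets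
  one computation serve \<open>e\<close> and \<open>f\<close>.\<close>

lemma sl2_relations_on_basis:
  fixes g :: "nat \<Rightarrow> 'v"
  assumes X: "\<And>i. i \<in> {1..r} \<Longrightarrow> X (g i) = (if i < r then g (i + 1) else 0)"
    and H: "\<And>i. i \<in> {1..r} \<Longrightarrow> H (g i) = (real r + 1 - 2 * real i) *\<^sub>R g i"
    and Y: "\<And>i. i \<in> {1..r} \<Longrightarrow>
      Y (g i) = (if 2 \<le> i then ((real i - 1) * (real r + 1 - real i)) *\<^sub>R g (i - 1) else 0)"
    and i: "i \<in> {1..r}"
  shows "lie_bracket H X (g i) = ((-2) *\<^sub>R X) (g i)"
    and "lie_bracket H Y (g i) = (2 *\<^sub>R Y) (g i)"
    and "lie_bracket Y X (g i) = H (g i)"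
proof -
  show "lie_bracket H X (g i) = ((-2) *\<^sub>R X) (g i)"
    using i by (simp add: lie_bracket_def blinfun.bilinear_simps X H scaleR_left_diff_distrib[symmetric])
  show "lie_bracket H Y (g i) = (2 *\<^sub>R Y) (g i)"
  proof (cases "i = 1")
    case False
    then obtain m where "i = Suc (Suc m)" using i by (cases i rule: nat.exhaust[case_product nat.exhaust]; cases "i - 1") auto
    then show ?thesis using i
      by (simp add: lie_bracket_def blinfun.bilinear_simps Y H scaleR_left_diff_distrib[symmetric])
        (simp add: algebra_simps)
  qed (use i in \<open>simp add: lie_bracket_def blinfun.bilinear_simps Y H\<close>)
  show "lie_bracket Y X (g i) = H (g i)"
  proof (cases "i = 1")
    case False
    then obtain m where "i = Suc (Suc m)" using i by (cases i rule: nat.exhaust[case_product nat.exhaust]; cases "i - 1") auto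
    then show ?thesis using i
      by (cases "i = r") (simp_all add: lie_bracket_def blinfun.bilinear_simps X Y H
          scaleR_left_diff_distrib[symmetric], simp_all add: algebra_simps)
  qed (use i in \<open>auto simp: lie_bracket_def blinfun.bilinear_simps X Y H\<close>)
qed

lemma sl2_relations: "lie_bracket H X = (-2) *\<^sub>R X" "lie_bracket H Y = 2 *\<^sub>R Y" "lie_bracket Y X = H"
  by (rule blinfun_eq_on_basis;
      rule sl2_relations_on_basis[OF X_e H_e Y_e] sl2_relations_on_basis[OF X_f H_f Y_f]; assumption)+

lemma skew_on_basis:
  fixes D :: "'v \<Rightarrow>\<^sub>L 'v"
  assumes "\<And>i j. i \<in> {1..r} \<Longrightarrow> j \<in> {1..r} \<Longrightarrow> \<sigma> (D (e i)) (e j) = - \<sigma> (e i) (D (e j))"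
    and "\<And>i j. i \<in> {1..r} \<Longrightarrow> j \<in> {1..r} \<Longrightarrow> \<sigma> (D (f i)) (f j) = - \<sigma> (f i) (D (f j))"
    and "\<And>i j. i \<in> {1..r} \<Longrightarrow> j \<in> {1..r} \<Longrightarrow> \<sigma> (D (e i)) (f j) = - \<sigma> (e i) (D (f j))"
  shows "\<sigma> (D u) v + \<sigma> u (D v) = 0"
proof -
  have bil: "bilinear (\<lambda>u v. \<sigma> (D u) v)" "bilinear (\<lambda>u v. - \<sigma> u (D v))"
    by (auto simp: bilinear_def blinfun.bilinear_simps sigma_simps algebra_simps intro!: linearI)
  have fe: "\<sigma> (D (f i)) (e j) = - \<sigma> (f i) (D (e j))" if "i \<in> {1..r}" "j \<in> {1..r}" for i j
    using assms(3)[OF that(2,1)] \<sigma>_skew[of "D (f i)" "e j"] \<sigma>_skew[of "f i" "D (e j)"] by simp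
  have basis: "\<sigma> (D u) v = - \<sigma> u (D v)"
    if "u \<in> e ` {1..r} \<union> f ` {1..r}" "v \<in> e ` {1..r} \<union> f ` {1..r}" for u v
    using that by (elim UnE imageE) (simp_all only: assms fe)
  have "\<sigma> (D u) v = - \<sigma> u (D v)"
    by (rule bilinear_eq[OF bil, of UNIV "e ` {1..r} \<union> f ` {1..r}" UNIV "e ` {1..r} \<union> f ` {1..r}"])
      (simp_all only: basis_span subset_refl UNIV_I basis)
  then show ?thesis by simp
qed

lemma skew_X: "\<sigma> (X u) v + \<sigma> u (X v) = 0"
  by (rule skew_on_basis) (auto simp: X_e X_f \<sigma>_ee \<sigma>_ff \<sigma>_ef sigma_simps)

lemma skew_H: "\<sigma> (H u) v + \<sigma> u (H v) = 0"
proof (rule skew_on_basis)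
  fix i j assume ij: "i \<in> {1..r}" "j \<in> {1..r}"
  show "\<sigma> (H (e i)) (f j) = - \<sigma> (e i) (H (f j))"
  proof (cases "i + j = r + 1")
    case True
    have "(real r + 1 - 2 * real i) = - (real r + 1 - 2 * real j)" using True by linarith
    then show ?thesis using ij True by (simp only: H_e H_f \<sigma>_ef sigma_simps) (simp add: algebra_simps)
  next
    case False
    then show ?thesis using ij by (simp add: H_e H_f \<sigma>_ef sigma_simps)
  qed
qed (auto simp: H_e H_f \<sigma>_ee \<sigma>_ff sigma_simps)

lemma skew_Y: "\<sigma> (Y u) v + \<sigma> u (Y v) = 0"
proof (rule skew_on_basis)
  fix i j assume ij: "i \<in> {1..r}" "j \<in> {1..r}"
  obtain m n where mn: "i = Suc m" "j = Suc n" using ij by (cases i; cases j) auto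
  show "\<sigma> (Y (e i)) (f j) = - \<sigma> (e i) (Y (f j))"
  \<comment> \<open>Both sides can be nonzero only here, where e_{i-1} pairs with f_j and e_i with
    f_{j-1}. Then r + 1 - i = j - 1, so both coefficients equal (i - 1)(j - 1), and the pairings
    differ by a sign.\<close>
  proof (cases "i + j = r + 2")
    case True
    then have "real r = real m + real n" "m \<ge> 1" "n \<ge> 1" using True ij by (auto simp: mn)
    then show ?thesis
      using ij True by (simp add: mn Y_e Y_f \<sigma>_ef sigma_simps)
  next
    case False
    then show ?thesis using ij by (cases "m = 0"; cases "n = 0") (simp_all add: mn Y_e Y_f \<sigma>_ef sigma_simps)
  qed
next
  fix i j assume ij: "i \<in> {1..r}" "j \<in> {1..r}"
  obtain m n where mn: "i = Suc m" "j = Suc n" using ij by (cases i; cases j) auto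
  show "\<sigma> (Y (e i)) (e j) = - \<sigma> (e i) (Y (e j))"
    using ij by (cases "m = 0"; cases "n = 0") (simp_all add: mn Y_e \<sigma>_ee sigma_simps)
  show "\<sigma> (Y (f i)) (f j) = - \<sigma> (f i) (Y (f j))"
    using ij by (cases "m = 0"; cases "n = 0") (simp_all add: mn Y_f \<sigma>_ff sigma_simps)
qed

section \<open>Quadratic polynomials and the symmetric square\<close>

abbreviation S2 :: "('v \<Rightarrow>\<^sub>L 'v) set" where "S2 \<equiv> sym2 r e \<sigma>"

text \<open>Up to the sign (-1)^i, the linear form x_i is the coordinate along f_{r+1-i}, because
  e_i pairs nontrivially with that basis vector only.\<close>

lemma Vf_expansion:
  assumes "v \<in> Vf"
  shows "v = (\<Sum>i=1..r. ((-1) ^ i * \<sigma> (e i) v) *\<^sub>R f (r + 1 - i))"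
proof (rule linear_eq_on_span[of "\<lambda>v. v" "\<lambda>v. \<Sum>i=1..r. ((-1) ^ i * \<sigma> (e i) v) *\<^sub>R f (r + 1 - i)" "f ` {1..r}"])
  show "linear (\<lambda>v. \<Sum>i=1..r. ((-1) ^ i * \<sigma> (e i) v) *\<^sub>R f (r + 1 - i))"
    by (intro linearI) (simp_all add: sigma_simps algebra_simps sum.distrib scaleR_sum_right)
  fix v assume "v \<in> f ` {1..r}"
  then obtain j where j: "v = f j" "j \<in> {1..r}" by blast
  have "(\<Sum>i=1..r. ((-1) ^ i * \<sigma> (e i) v) *\<^sub>R f (r + 1 - i)) =
      (\<Sum>i=1..r. if i = r + 1 - j then f j else 0)"
    using j by (intro sum.cong) (auto simp: \<sigma>_ef)
  then show "v = (\<Sum>i=1..r. ((-1) ^ i * \<sigma> (e i) v) *\<^sub>R f (r + 1 - i))"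
    using j by (auto simp: sum.delta)
qed (use assms in \<open>auto simp: linear_id[unfolded id_def]\<close>)

lemma Ve_expansion:
  assumes "v \<in> Ve"
  shows "v = (\<Sum>i=1..r. ((-1) ^ (r + 1 - i) * \<sigma> v (f i)) *\<^sub>R e (r + 1 - i))"
proof (rule linear_eq_on_span[of "\<lambda>v. v" "\<lambda>v. \<Sum>i=1..r. ((-1) ^ (r + 1 - i) * \<sigma> v (f i)) *\<^sub>R e (r + 1 - i)" "e ` {1..r}"])
  show "linear (\<lambda>v. \<Sum>i=1..r. ((-1) ^ (r + 1 - i) * \<sigma> v (f i)) *\<^sub>R e (r + 1 - i))"
    by (intro linearI) (simp_all add: sigma_simps algebra_simps sum.distrib scaleR_sum_right)
  fix v assume "v \<in> e ` {1..r}"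
  then obtain j where j: "v = e j" "j \<in> {1..r}" by blast
  have "(\<Sum>i=1..r. ((-1) ^ (r + 1 - i) * \<sigma> v (f i)) *\<^sub>R e (r + 1 - i)) =
      (\<Sum>i=1..r. if i = r + 1 - j then e j else 0)"
    using j by (intro sum.cong) (auto simp: \<sigma>_ef)
  then show "v = (\<Sum>i=1..r. ((-1) ^ (r + 1 - i) * \<sigma> v (f i)) *\<^sub>R e (r + 1 - i))"
    using j by (auto simp: sum.delta)
qed (use assms in \<open>auto simp: linear_id[unfolded id_def]\<close>)

lemma Ve_eq_0:
  assumes "v \<in> Ve" "\<And>i. i \<in> {1..r} \<Longrightarrow> \<sigma> v (f i) = 0"
  shows "v = 0"
  by (subst Ve_expansion[OF assms(1)]) (simp add: assms(2))

lemma S2_D: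
  assumes "A \<in> S2"
  shows "u \<in> Ve \<Longrightarrow> A u = 0" "A u \<in> Ve" "\<sigma> (A u) v = \<sigma> (A v) u"
proof -
  show "u \<in> Ve \<Longrightarrow> A u = 0" "A u \<in> Ve" using assms by (auto simp: sym2_def)
  have "\<sigma> (A u) v + \<sigma> u (A v) = 0" using assms by (auto simp: sym2_def)
  then show "\<sigma> (A u) v = \<sigma> (A v) u" using \<sigma>_skew[of u "A v"] by simp
qed

lemma S2_eq_0:
  assumes A: "A \<in> S2" and "\<And>i j. i \<in> {1..r} \<Longrightarrow> j \<in> {1..r} \<Longrightarrow> \<sigma> (A (f i)) (f j) = 0"
  shows "A = 0"
proof (rule blinfun_eq_on_basis)
  fix i assume "i \<in> {1..r}"
  then show "A (e i) = (0 :: 'v \<Rightarrow>\<^sub>L 'v) (e i)" "A (f i) = (0 :: 'v \<Rightarrow>\<^sub>L 'v) (f i)"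
    using S2_D(1)[OF A, of "e i"] Ve_eq_0[OF S2_D(2)[OF A, of "f i"]] assms(2)
    by (simp_all add: span_base)
qed

lemma subspace_S2: "subspace S2"
  unfolding subspace_def sym2_def
  by (auto simp: blinfun.bilinear_simps sigma_simps span_zero span_add span_scale algebra_simps
      simp flip: distrib_left)

lemma lie_bracket_in_S2:
  fixes D :: "'v \<Rightarrow>\<^sub>L 'v"
  assumes A: "A \<in> S2" and D: "\<And>u v. \<sigma> (D u) v + \<sigma> u (D v) = 0" "\<And>i. i \<in> {1..r} \<Longrightarrow> D (e i) \<in> Ve"
  shows "lie_bracket D A \<in> S2"
proof -
  have "span (D ` e ` {1..r}) \<subseteq> Ve"
    using D(2) by (intro span_minimal subspace_span) blast
  then have Ve: "u \<in> Ve \<Longrightarrow> D u \<in> Ve" for u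
    using linear_span_image[OF blinfun.bounded_linear_right[THEN bounded_linear.linear], of D "e ` {1..r}"]
    by blast
  have skew: "\<sigma> (A u) v = - \<sigma> u (A v)" "\<sigma> (D u) v = - \<sigma> u (D v)" for u v
    using A D(1)[of u v] by (auto simp: sym2_def eq_neg_iff_add_eq_0)
  show ?thesis
    unfolding sym2_def lie_bracket_def
    by (auto simp: blinfun.bilinear_simps sigma_simps S2_D(1,2)[OF A] Ve skew simp del: One_nat_def
        intro!: span_diff)
qed

lemma X_e_Ve: "i \<in> {1..r} \<Longrightarrow> X (e i) \<in> Ve"
  by (auto simp: X_e span_zero intro: span_base)

lemma H_e_Ve: "i \<in> {1..r} \<Longrightarrow> H (e i) \<in> Ve"
  by (simp add: H_e span_base span_scale)

lemma Y_e_Ve: "i \<in> {1..r} \<Longrightarrow> Y (e i) \<in> Ve"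
proof (cases "i \<le> 1")
  case False
  assume "i \<in> {1..r}"
  then have "e (i - 1) \<in> Ve" using False by (intro span_base imageI) auto
  then show ?thesis using \<open>i \<in> {1..r}\<close> by (simp only: Y_e span_scale span_zero split: if_split) simp
qed (auto simp: Y_e span_zero)

text \<open>The product of e_a and e_b in the symmetric square of Ve. The factor 1/2 makes its
  quadratic polynomial exactly x_a x_b.\<close>

definition sym_product :: "nat \<Rightarrow> nat \<Rightarrow> 'v \<Rightarrow>\<^sub>L 'v" where
  "sym_product a b = Blinfun (\<lambda>v. (1/2) *\<^sub>R (\<sigma> (e a) v *\<^sub>R e b + \<sigma> (e b) v *\<^sub>R e a))"

lemma sym_product_apply: "sym_product a b v = (1/2) *\<^sub>R (\<sigma> (e a) v *\<^sub>R e b + \<sigma> (e b) v *\<^sub>R e a)"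
proof -
  have "linear (\<lambda>v. (1/2) *\<^sub>R (\<sigma> (e a) v *\<^sub>R e b + \<sigma> (e b) v *\<^sub>R e a))"
    by (intro linearI) (simp_all add: sigma_simps algebra_simps)
  then show ?thesis
    unfolding sym_product_def by (simp add: bounded_linear_Blinfun_apply linear_conv_bounded_linear)
qed

lemma sym_product_in_S2:
  assumes "a \<in> {1..r}" "b \<in> {1..r}"
  shows "sym_product a b \<in> S2"
proof -
  have "\<sigma> (e i) u = 0" if "i \<in> {1..r}" "u \<in> Ve" for i u
  proof -
    have "Ve \<subseteq> {u. \<sigma> (e i) u = 0}"
      using \<sigma>_ee[OF that(1)] by (intro span_minimal linear_subspace_kernel linear_sigma) blast
    then show ?thesis using that(2) by blast
  qed
  moreover have "\<sigma> u (e i) = - \<sigma> (e i) u" for u i by (rule \<sigma>_skew)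
  ultimately show ?thesis
    using assms unfolding sym2_def
    by (auto simp: sym_product_apply sigma_simps field_simps span_add span_scale span_base simp del: One_nat_def)
qed

lemma quadratic_poly_sym_product:
  "v \<in> Vf \<Longrightarrow> quadratic_poly r f \<sigma> (sym_product a b) v = \<sigma> (e a) v * \<sigma> (e b) v"
  by (simp add: quadratic_poly_def sym_product_apply sigma_simps)

lemma weight_sym_product:
  assumes "a \<in> {1..r}" "b \<in> {1..r}"
  shows "lie_bracket H (sym_product a b) = (2 * (real r + 1 - real a - real b)) *\<^sub>R sym_product a b"
proof (rule blinfun_eqI)
  fix v
  define w where "w i = real r + 1 - 2 * real i" for i
  have He: "H (e i) = w i *\<^sub>R e i" and H: "\<sigma> (e i) (H v) = - w i * \<sigma> (e i) v" if "i \<in> {1..r}" for i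
    using skew_H[of "e i" v] H_e[OF that] by (simp_all add: w_def sigma_simps eq_neg_iff_add_eq_0 algebra_simps)
  have "lie_bracket H (sym_product a b) v =
      ((1/2) * (\<sigma> (e a) v * w b + w a * \<sigma> (e a) v)) *\<^sub>R e b + ((1/2) * (\<sigma> (e b) v * w a + w b * \<sigma> (e b) v)) *\<^sub>R e a"
    unfolding lie_bracket_def
    by (simp only: blinfun.diff_left blinfun_apply_blinfun_compose sym_product_apply blinfun.bilinear_simps
        He assms H) (simp add: algebra_simps)
  also have "(1/2) * (\<sigma> (e a) v * w b + w a * \<sigma> (e a) v) = (real r + 1 - real a - real b) * \<sigma> (e a) v"
    by (simp add: w_def field_simps)
  also have "(1/2) * (\<sigma> (e b) v * w a + w b * \<sigma> (e b) v) = (real r + 1 - real a - real b) * \<sigma> (e b) v"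
    by (simp add: w_def field_simps)
  finally have eq: "lie_bracket H (sym_product a b) v = ((real r + 1 - real a - real b) * \<sigma> (e a) v) *\<^sub>R e b +
      ((real r + 1 - real a - real b) * \<sigma> (e b) v) *\<^sub>R e a" .
  have "((2 * c) *\<^sub>R sym_product a b) v = (c * \<sigma> (e a) v) *\<^sub>R e b + (c * \<sigma> (e b) v) *\<^sub>R e a" for c
    by (simp add: blinfun.scaleR_left sym_product_apply scaleR_add_right)
  then show "lie_bracket H (sym_product a b) v = ((2 * (real r + 1 - real a - real b)) *\<^sub>R sym_product a b) v"
    using eq by (simp only:)
qed

section \<open>Homogeneous polynomials in the coordinates, and S^2(Ve) as quadratic
  polynomials\<close>

definition monomials :: "nat \<Rightarrow> (nat \<Rightarrow> nat) set" where
  "monomials m = {\<alpha> \<in> {1..r} \<rightarrow>\<^sub>E {..m}. (\<Sum>i=1..r. \<alpha> i) = m}"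

lemma finite_monomials: "finite (monomials m)"
  unfolding monomials_def by (rule finite_subset[of _ "{1..r} \<rightarrow>\<^sub>E {..m}"]) (auto intro: finite_PiE)

lemma hom_polys_iff:
  "F \<in> hom_polys r e f \<sigma> m \<longleftrightarrow>
    (\<exists>c. F = (\<lambda>v \<in> Vf. \<Sum>\<alpha>\<in>monomials m. c \<alpha> * (\<Prod>i=1..r. \<sigma> (e i) v ^ \<alpha> i)))"
  by (simp add: hom_polys_def monomials_def)

lemma hom_polys_monomial:
  assumes "\<alpha> \<in> monomials m"
  shows "(\<lambda>v \<in> Vf. \<Prod>i=1..r. \<sigma> (e i) v ^ \<alpha> i) \<in> hom_polys r e f \<sigma> m"
proof -
  have "(\<Sum>\<beta>\<in>monomials m. of_bool (\<beta> = \<alpha>) * (\<Prod>i=1..r. \<sigma> (e i) v ^ \<beta> i)) = (\<Prod>i=1..r. \<sigma> (e i) v ^ \<alpha> i)" for v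
  proof -
    have "(\<Sum>\<beta>\<in>monomials m. of_bool (\<beta> = \<alpha>) * (\<Prod>i=1..r. \<sigma> (e i) v ^ \<beta> i)) =
        (\<Sum>\<beta>\<in>monomials m. if \<beta> = \<alpha> then (\<Prod>i=1..r. \<sigma> (e i) v ^ \<alpha> i) else 0)"
      by (intro sum.cong) auto
    then show ?thesis using assms by (simp add: sum.delta' sum.delta finite_monomials)
  qed
  then show ?thesis unfolding hom_polys_iff by (intro exI[of _ "\<lambda>\<beta>. of_bool (\<beta> = \<alpha>)"]) auto
qed

lemma hom_polys_sum:
  assumes "finite I" "\<And>i. i \<in> I \<Longrightarrow> F i \<in> hom_polys r e f \<sigma> m"
  shows "(\<lambda>v \<in> Vf. \<Sum>i\<in>I. c i * F i v) \<in> hom_polys r e f \<sigma> m"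
proof -
  have "\<forall>i\<in>I. \<exists>d. F i = (\<lambda>v \<in> Vf. \<Sum>\<alpha>\<in>monomials m. d \<alpha> * (\<Prod>i=1..r. \<sigma> (e i) v ^ \<alpha> i))"
    using assms(2) unfolding hom_polys_iff by blast
  from bchoice[OF this] obtain d where d: "\<And>i. i \<in> I \<Longrightarrow>
      F i = (\<lambda>v \<in> Vf. \<Sum>\<alpha>\<in>monomials m. d i \<alpha> * (\<Prod>i=1..r. \<sigma> (e i) v ^ \<alpha> i))"
    by blast
  have "(\<Sum>i\<in>I. c i * F i v) = (\<Sum>\<alpha>\<in>monomials m. (\<Sum>i\<in>I. c i * d i \<alpha>) * (\<Prod>i=1..r. \<sigma> (e i) v ^ \<alpha> i))"
    if "v \<in> Vf" for v
  proof -
    have "(\<Sum>i\<in>I. c i * F i v) = (\<Sum>i\<in>I. \<Sum>\<alpha>\<in>monomials m. c i * d i \<alpha> * (\<Prod>i=1..r. \<sigma> (e i) v ^ \<alpha> i))"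
      using that by (intro sum.cong) (simp_all add: d sum_distrib_left mult.assoc)
    also have "\<dots> = (\<Sum>\<alpha>\<in>monomials m. \<Sum>i\<in>I. c i * d i \<alpha> * (\<Prod>i=1..r. \<sigma> (e i) v ^ \<alpha> i))"
      by (rule sum.swap)
    finally show ?thesis by (simp add: sum_distrib_right)
  qed
  then show ?thesis unfolding hom_polys_iff
    by (intro exI[of _ "\<lambda>\<alpha>. \<Sum>i\<in>I. c i * d i \<alpha>"]) (auto intro!: restrict_ext)
qed

lemma hom_polys_const: "(\<lambda>v \<in> Vf. c) \<in> hom_polys r e f \<sigma> 0"
proof -
  have "(\<lambda>i\<in>{1..r}. 0) \<in> monomials 0" by (auto simp: monomials_def)
  note hom_polys_monomial[OF this]
  also have "(\<lambda>v \<in> Vf. \<Prod>i=1..r. \<sigma> (e i) v ^ (\<lambda>i\<in>{1..r}. 0) i) = (\<lambda>v \<in> Vf. 1)"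
    by (rule restrict_ext) simp
  finally have one: "(\<lambda>v \<in> Vf. 1) \<in> hom_polys r e f \<sigma> 0" .
  have "(\<lambda>v \<in> Vf. \<Sum>i\<in>{()}. c * (\<lambda>v \<in> Vf. 1) v) \<in> hom_polys r e f \<sigma> 0"
    by (rule hom_polys_sum) (simp, rule one)
  also have "(\<lambda>v \<in> Vf. \<Sum>i\<in>{()}. c * (\<lambda>v \<in> Vf. 1) v) = (\<lambda>v \<in> Vf. c)"
    by (rule restrict_ext) simp
  finally show ?thesis .
qed

lemma hom_polys_coord_mult:
  assumes "F \<in> hom_polys r e f \<sigma> m" "a \<in> {1..r}"
  shows "(\<lambda>v \<in> Vf. \<sigma> (e a) v * F v) \<in> hom_polys r e f \<sigma> (Suc m)"
proof -
  obtain c where c: "F = (\<lambda>v \<in> Vf. \<Sum>\<alpha>\<in>monomials m. c \<alpha> * (\<Prod>i=1..r. \<sigma> (e i) v ^ \<alpha> i))"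
    using assms(1) unfolding hom_polys_iff by blast
  let ?up = "\<lambda>\<alpha>::nat \<Rightarrow> nat. \<alpha>(a := Suc (\<alpha> a))"
  have up: "?up \<alpha> \<in> monomials (Suc m)" if "\<alpha> \<in> monomials m" for \<alpha>
  proof -
    have "(\<Sum>i=1..r. ?up \<alpha> i) = Suc (\<Sum>i=1..r. \<alpha> i)"
      using assms(2) by (subst (1 2) sum.remove[of _ a]) auto
    moreover have "?up \<alpha> \<in> {1..r} \<rightarrow>\<^sub>E {..Suc m}"
      using that assms(2) by (auto simp: monomials_def PiE_iff extensional_def intro: le_SucI)
    ultimately show ?thesis using that by (simp add: monomials_def)
  qed
  have prod: "\<sigma> (e a) v * (\<Prod>i=1..r. \<sigma> (e i) v ^ \<alpha> i) = (\<Prod>i=1..r. \<sigma> (e i) v ^ ?up \<alpha> i)" for \<alpha> v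
    using assms(2) by (subst (1 2) prod.remove[of _ a]) (auto simp: mult.assoc)
  have "(\<lambda>v \<in> Vf. \<Sum>\<alpha>\<in>monomials m. c \<alpha> * (\<lambda>v \<in> Vf. \<Prod>i=1..r. \<sigma> (e i) v ^ ?up \<alpha> i) v)
      \<in> hom_polys r e f \<sigma> (Suc m)"
    by (intro hom_polys_sum finite_monomials hom_polys_monomial up)
  also have "(\<lambda>v \<in> Vf. \<Sum>\<alpha>\<in>monomials m. c \<alpha> * (\<lambda>v \<in> Vf. \<Prod>i=1..r. \<sigma> (e i) v ^ ?up \<alpha> i) v) =
      (\<lambda>v \<in> Vf. \<sigma> (e a) v * F v)"
    by (intro restrict_ext)
      (simp add: c sum_distrib_left prod[symmetric] mult.left_commute del: fun_upd_apply One_nat_def)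
  finally show ?thesis .
qed

text \<open>Positive total degree forces a positive exponent; lowering it by one splits off a
  coordinate. Two applications write every quadratic monomial as x_a x_b.\<close>

lemma monomial_Suc_factor:
  fixes \<alpha> :: "'i \<Rightarrow> nat" and z :: "'j \<Rightarrow> 'i \<Rightarrow> 'c::comm_monoid_mult"
  assumes "finite I" "(\<Sum>i\<in>I. \<alpha> i) = Suc m"
  obtains a \<beta> where "a \<in> I" "(\<Sum>i\<in>I. \<beta> i) = m" "\<And>v. (\<Prod>i\<in>I. z v i ^ \<alpha> i) = z v a * (\<Prod>i\<in>I. z v i ^ \<beta> i)"
proof -
  obtain a where a: "a \<in> I" "\<alpha> a \<noteq> 0" using assms by (metis nat.distinct(1) sum.neutral)
  then obtain d where d: "\<alpha> a = Suc d" using not0_implies_Suc by blast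
  let ?\<beta> = "\<alpha>(a := d)"
  have "(\<Sum>i\<in>I. \<alpha> i) = \<alpha> a + (\<Sum>i\<in>I - {a}. \<alpha> i)" "(\<Sum>i\<in>I. ?\<beta> i) = d + (\<Sum>i\<in>I - {a}. ?\<beta> i)"
    using assms(1) a by (auto simp: sum.remove)
  moreover have "(\<Sum>i\<in>I - {a}. \<alpha> i) = (\<Sum>i\<in>I - {a}. ?\<beta> i)" by (intro sum.cong) auto
  ultimately have "(\<Sum>i\<in>I. ?\<beta> i) = m" using assms(2) d by linarith
  moreover have "(\<Prod>i\<in>I. z v i ^ \<alpha> i) = z v a * (\<Prod>i\<in>I. z v i ^ ?\<beta> i)" for v
  proof -
    have "(\<Prod>i\<in>I - {a}. z v i ^ \<alpha> i) = (\<Prod>i\<in>I - {a}. z v i ^ ?\<beta> i)" by (intro prod.cong) auto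
    then show ?thesis
      unfolding prod.remove[OF assms(1) a(1)] using d by (simp only: fun_upd_same power_Suc mult.assoc)
  qed
  ultimately show ?thesis by (rule that[OF a(1)])
qed

text \<open>\<open>Vf_expansion\<close> is applied twice, once to the argument of \<open>A\<close>
  and once in the second slot of the form, where \<open>inner\<close> expresses a linear form
  through the coordinates.\<close>

lemma quadratic_poly_in_hom_polys:
  "quadratic_poly r f \<sigma> A \<in> hom_polys r e f \<sigma> 2"
proof -
  have inner: "(\<lambda>v \<in> Vf. \<sigma> w v) \<in> hom_polys r e f \<sigma> 1" for w
  proof -
    have "(\<lambda>v \<in> Vf. \<Sum>i=1..r. ((-1) ^ i * \<sigma> w (f (r + 1 - i))) * (\<lambda>v \<in> Vf. \<sigma> (e i) v * (\<lambda>v \<in> Vf. 1) v) v)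
        \<in> hom_polys r e f \<sigma> (Suc 0)"
      by (intro hom_polys_sum hom_polys_coord_mult hom_polys_const) auto
    also have "(\<lambda>v \<in> Vf. \<Sum>i=1..r. ((-1) ^ i * \<sigma> w (f (r + 1 - i))) * (\<lambda>v \<in> Vf. \<sigma> (e i) v * (\<lambda>v \<in> Vf. 1) v) v) =
        (\<lambda>v \<in> Vf. \<sigma> w v)"
    proof (rule restrict_ext)
      fix v assume v: "v \<in> Vf"
      have "\<sigma> w v = (\<Sum>i=1..r. \<sigma> w (((-1) ^ i * \<sigma> (e i) v) *\<^sub>R f (r + 1 - i)))"
        by (subst Vf_expansion[OF v]) (rule linear_sum[OF linear_sigma(1)])
      then show "(\<Sum>i=1..r. ((-1) ^ i * \<sigma> w (f (r + 1 - i))) * (\<lambda>v \<in> Vf. \<sigma> (e i) v * (\<lambda>v \<in> Vf. 1) v) v) = \<sigma> w v"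
        using v by (simp add: sigma_simps algebra_simps)
    qed
    finally show ?thesis unfolding One_nat_def .
  qed
  have "(\<lambda>v \<in> Vf. \<Sum>i=1..r. (-1) ^ i * (\<lambda>v \<in> Vf. \<sigma> (e i) v * (\<lambda>v \<in> Vf. \<sigma> (A (f (r + 1 - i))) v) v) v)
      \<in> hom_polys r e f \<sigma> (Suc 1)"
    by (intro hom_polys_sum hom_polys_coord_mult inner) auto
  also have "(\<lambda>v \<in> Vf. \<Sum>i=1..r. (-1) ^ i * (\<lambda>v \<in> Vf. \<sigma> (e i) v * (\<lambda>v \<in> Vf. \<sigma> (A (f (r + 1 - i))) v) v) v) =
      quadratic_poly r f \<sigma> A"
    unfolding quadratic_poly_def
  proof (rule restrict_ext)
    fix v assume v: "v \<in> Vf"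
    have "A v = (\<Sum>i=1..r. ((-1) ^ i * \<sigma> (e i) v) *\<^sub>R A (f (r + 1 - i)))"
      by (subst Vf_expansion[OF v]) (simp add: blinfun.bilinear_simps)
    then have "\<sigma> (A v) v = (\<Sum>i=1..r. \<sigma> (((-1) ^ i * \<sigma> (e i) v) *\<^sub>R A (f (r + 1 - i))) v)"
      by (simp only: linear_sum[OF linear_sigma(2)])
    then show "(\<Sum>i=1..r. (-1) ^ i * (\<lambda>v \<in> Vf. \<sigma> (e i) v * (\<lambda>v \<in> Vf. \<sigma> (A (f (r + 1 - i))) v) v) v) = \<sigma> (A v) v"
      using v by (simp add: sigma_simps algebra_simps)
  qed
  finally show ?thesis by (simp add: numeral_2_eq_2)
qed

lemma hom_polys_2_quadratic_poly:
  assumes "F \<in> hom_polys r e f \<sigma> 2"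
  obtains A where "A \<in> span {sym_product a b | a b. a \<in> {1..r} \<and> b \<in> {1..r}}" "F = quadratic_poly r f \<sigma> A"
proof -
  obtain c where c: "F = (\<lambda>v \<in> Vf. \<Sum>\<alpha>\<in>monomials 2. c \<alpha> * (\<Prod>i=1..r. \<sigma> (e i) v ^ \<alpha> i))"
    using assms unfolding hom_polys_iff by blast
  have "\<exists>a b. a \<in> {1..r} \<and> b \<in> {1..r} \<and> (\<forall>v. (\<Prod>i=1..r. \<sigma> (e i) v ^ \<alpha> i) = \<sigma> (e a) v * \<sigma> (e b) v)"
    if "\<alpha> \<in> monomials 2" for \<alpha>
  proof -
    have "(\<Sum>i=1..r. \<alpha> i) = Suc 1" using that by (simp add: monomials_def)
    then obtain a \<beta> where a: "a \<in> {1..r}" "(\<Sum>i=1..r. \<beta> i) = Suc 0"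
      "\<And>v. (\<Prod>i=1..r. \<sigma> (e i) v ^ \<alpha> i) = \<sigma> (e a) v * (\<Prod>i=1..r. \<sigma> (e i) v ^ \<beta> i)"
      by (rule monomial_Suc_factor[OF finite_atLeastAtMost, where z = "\<lambda>v i. \<sigma> (e i) v"]) auto
    obtain b \<gamma> where b: "b \<in> {1..r}" "(\<Sum>i=1..r. \<gamma> i) = 0"
      "\<And>v. (\<Prod>i=1..r. \<sigma> (e i) v ^ \<beta> i) = \<sigma> (e b) v * (\<Prod>i=1..r. \<sigma> (e i) v ^ \<gamma> i)"
      by (rule monomial_Suc_factor[OF finite_atLeastAtMost a(2), where z = "\<lambda>v i. \<sigma> (e i) v"]) auto
    have "(\<Prod>i=1..r. \<sigma> (e i) v ^ \<gamma> i) = 1" for v using b(2) by (intro prod.neutral) auto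
    then show ?thesis using a b by (intro exI[of _ a] exI[of _ b]) simp
  qed
  then obtain a b where ab: "\<And>\<alpha>. \<alpha> \<in> monomials 2 \<Longrightarrow> a \<alpha> \<in> {1..r} \<and> b \<alpha> \<in> {1..r} \<and>
      (\<forall>v. (\<Prod>i=1..r. \<sigma> (e i) v ^ \<alpha> i) = \<sigma> (e (a \<alpha>)) v * \<sigma> (e (b \<alpha>)) v)"
    by metis
  let ?A = "\<Sum>\<alpha>\<in>monomials 2. c \<alpha> *\<^sub>R sym_product (a \<alpha>) (b \<alpha>)"
  have "F = quadratic_poly r f \<sigma> ?A"
    unfolding c quadratic_poly_def
  proof (rule restrict_ext)
    fix v assume v: "v \<in> Vf"
    have "\<sigma> (?A v) v = (\<Sum>\<alpha>\<in>monomials 2. c \<alpha> * \<sigma> (sym_product (a \<alpha>) (b \<alpha>) v) v)"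
      by (simp add: blinfun.bilinear_simps linear_sum[OF linear_sigma(2)] sigma_simps)
    then show "(\<Sum>\<alpha>\<in>monomials 2. c \<alpha> * (\<Prod>i=1..r. \<sigma> (e i) v ^ \<alpha> i)) = \<sigma> (?A v) v"
      using ab quadratic_poly_sym_product[OF v] v by (simp add: quadratic_poly_def)
  qed
  moreover have "?A \<in> span {sym_product a b | a b. a \<in> {1..r} \<and> b \<in> {1..r}}"
    using ab by (intro span_sum span_scale span_base) blast
  ultimately show ?thesis using that by blast
qed

text \<open>Polarisation: the values of the difference at f_i, f_j and f_i + f_j determine its entry
  (i, j), since its bilinear form is symmetric.\<close>

lemma inj_on_quadratic_poly: "inj_on (quadratic_poly r f \<sigma>) S2"
proof (rule inj_onI)
  fix A A' assume A: "A \<in> S2" "A' \<in> S2" and eq: "quadratic_poly r f \<sigma> A = quadratic_poly r f \<sigma> A'"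
  have D: "A - A' \<in> S2" using A subspace_S2 subspace_diff by blast
  have Q: "\<sigma> ((A - A') v) v = 0" if "v \<in> Vf" for v
    using fun_cong[OF eq, of v] that by (simp add: quadratic_poly_def blinfun.bilinear_simps sigma_simps)
  have "\<sigma> ((A - A') (f i)) (f j) = 0" if "i \<in> {1..r}" "j \<in> {1..r}" for i j
  proof -
    have "f i \<in> Vf" "f j \<in> Vf" using that by (auto intro: span_base)
    then show ?thesis
      using Q[of "f i"] Q[of "f j"] Q[of "f i + f j"] S2_D(3)[OF D, of "f i" "f j"]
      by (simp add: span_add blinfun.add_right sigma_simps del: blinfun_apply_inverse)
  qed
  then have "A - A' = 0" by (intro S2_eq_0[OF D])
  then show "A = A'" by simp
qed

text \<open>The polynomial of any \<open>A\<close> in \<open>S2\<close> is also that of a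
  combination of symmetric products; injectivity identifies the two without counting
  dimensions.\<close>

lemma S2_eq_span: "S2 = span {sym_product a b | a b. a \<in> {1..r} \<and> b \<in> {1..r}}"
proof
  show le: "span {sym_product a b | a b. a \<in> {1..r} \<and> b \<in> {1..r}} \<subseteq> S2"
    using sym_product_in_S2 by (intro span_minimal subspace_S2) auto
  show "S2 \<subseteq> span {sym_product a b | a b. a \<in> {1..r} \<and> b \<in> {1..r}}"
  proof
    fix A assume A: "A \<in> S2"
    obtain A' where "A' \<in> span {sym_product a b | a b. a \<in> {1..r} \<and> b \<in> {1..r}}"
      "quadratic_poly r f \<sigma> A = quadratic_poly r f \<sigma> A'"
      by (rule hom_polys_2_quadratic_poly[OF quadratic_poly_in_hom_polys])
    then show "A \<in> span {sym_product a b | a b. a \<in> {1..r} \<and> b \<in> {1..r}}"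
      using inj_onD[OF inj_on_quadratic_poly, of A A'] A le by blast
  qed
qed

text \<open>The relations follow from those of the triple by the Jacobi identity. The symmetric
  products are weight vectors of weight 2(r + 1 - a - b), an integer in [-2r, 2r], and they span
  \<open>S2\<close>.\<close>

lemma sl2_module_S2: "sl2_module (lie_bracket X) (lie_bracket H) (lie_bracket Y) S2 (2 * r)"
proof (rule sl2_module.intro)
  fix A
  show "lie_bracket H (lie_bracket X A) - lie_bracket X (lie_bracket H A) = (- 2) *\<^sub>R lie_bracket X A"
    "lie_bracket H (lie_bracket Y A) - lie_bracket Y (lie_bracket H A) = 2 *\<^sub>R lie_bracket Y A"
    "lie_bracket Y (lie_bracket X A) - lie_bracket X (lie_bracket Y A) = lie_bracket H A"
    by (simp_all only: lie_bracket_jacobi sl2_relations lie_bracket_scaleR_left)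
  show "lie_bracket X A \<in> S2 \<and> lie_bracket H A \<in> S2 \<and> lie_bracket Y A \<in> S2" if "A \<in> S2"
    using that by (intro conjI lie_bracket_in_S2 skew_X skew_H skew_Y X_e_Ve H_e_Ve Y_e_Ve)
  let ?I = "real_of_int ` {- int (2 * r)..int (2 * r)}"
  let ?P = "\<lambda>A. \<exists>c. A = (\<Sum>w\<in>?I. c w) \<and> (\<forall>w\<in>?I. c w \<in> S2 \<and> lie_bracket H (c w) = w *\<^sub>R c w)"
  note H = linear_add[OF linear_lie_bracket] linear_scale[OF linear_lie_bracket] linear_0[OF linear_lie_bracket]
  show "?P A" if "A \<in> S2"
  proof -
    have "subspace (Collect ?P)"
    proof (rule subspaceI)
      show "0 \<in> Collect ?P"
        by (intro CollectI exI[of _ "\<lambda>_. 0"]) (auto simp: H subspace_0[OF subspace_S2])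
      show "A + B \<in> Collect ?P" if "A \<in> Collect ?P" "B \<in> Collect ?P" for A B
      proof -
        obtain c d where
          "A = (\<Sum>w\<in>?I. c w)" "\<forall>w\<in>?I. c w \<in> S2 \<and> lie_bracket H (c w) = w *\<^sub>R c w"
          "B = (\<Sum>w\<in>?I. d w)" "\<forall>w\<in>?I. d w \<in> S2 \<and> lie_bracket H (d w) = w *\<^sub>R d w"
          using \<open>A \<in> Collect ?P\<close> \<open>B \<in> Collect ?P\<close> by blast
        then show ?thesis
          by (intro CollectI exI[of _ "\<lambda>w. c w + d w"])
            (auto simp: H sum.distrib subspace_add[OF subspace_S2] scaleR_add_right)
      qed
      show "a *\<^sub>R A \<in> Collect ?P" if "A \<in> Collect ?P" for A a
      proof -
        obtain c where
          "A = (\<Sum>w\<in>?I. c w)" "\<forall>w\<in>?I. c w \<in> S2 \<and> lie_bracket H (c w) = w *\<^sub>R c w"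
          using \<open>A \<in> Collect ?P\<close> by blast
        then show ?thesis
          by (intro CollectI exI[of _ "\<lambda>w. a *\<^sub>R c w"])
            (auto simp: H scaleR_sum_right subspace_scale[OF subspace_S2])
      qed
    qed
    moreover have "?P (sym_product a b)" if ab: "a \<in> {1..r}" "b \<in> {1..r}" for a b
    proof -
      let ?w = "2 * (real r + 1 - real a - real b)"
      have "?w = real_of_int (2 * (int r + 1 - int a - int b))" by simp
      moreover have "2 * (int r + 1 - int a - int b) \<in> {- int (2 * r)..int (2 * r)}" using ab by auto
      ultimately have "?w \<in> ?I" by (rule image_eqI)
      then show ?thesis
        using weight_sym_product[OF ab] sym_product_in_S2[OF ab]
        by (intro exI[of _ "\<lambda>w. if w = ?w then sym_product a b else 0"])
          (auto simp: H subspace_0[OF subspace_S2] sum.delta)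
    qed
    ultimately have "span {sym_product a b | a b. a \<in> {1..r} \<and> b \<in> {1..r}} \<subseteq> Collect ?P"
      by (intro span_minimal) auto
    then show ?thesis using that S2_eq_span by auto
  qed
qed (intro linear_lie_bracket subspace_S2)+

sublocale ad: sl2_module "lie_bracket X" "lie_bracket H" "lie_bracket Y" S2 "2 * r"
  by (rule sl2_module_S2)

lemma sl2_submodule_iff: "sl2_submodule X H Y U \<longleftrightarrow> ad.submodule U"
  by (simp add: sl2_submodule_def ad.submodule_def)

lemma sl2_irreducible_iff: "sl2_irreducible X H Y U \<longleftrightarrow> ad.irreducible U"
  by (simp add: sl2_irreducible_def ad.irreducible_def sl2_submodule_iff)

end

section \<open>Quadrics containing the osculating planes\<close>

text \<open>The recursion moves one step along the antidiagonal and only changes the sign, so all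
  its entries with positive indices have the same absolute value.\<close>

lemma antidiagonal_vanishes:
  fixes b :: "nat \<Rightarrow> nat \<Rightarrow> real"
  assumes rec: "\<And>i j. \<lbrakk>i \<ge> 1; j \<ge> 1; Suc (i + j) = s\<rbrakk> \<Longrightarrow> b (Suc i) j = - b i (Suc j)"
    and p: "p \<ge> 1" "q \<ge> 1" "p + q = s" "b p q = 0"
    and ij: "i \<ge> 1" "j \<ge> 1" "i + j = s"
  shows "b i j = 0"
proof -
  have step: "\<bar>b (Suc i) (s - Suc i)\<bar> = \<bar>b 1 (s - 1)\<bar>" if "Suc i < s" for i
    using that
  proof (induction i)
    case (Suc i)
    then have "b (Suc (Suc i)) (s - Suc (Suc i)) = - b (Suc i) (Suc (s - Suc (Suc i)))"
      by (intro rec) auto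
    also have "Suc (s - Suc (Suc i)) = s - Suc i" using Suc.prems by simp
    finally show ?case using Suc by simp
  qed simp
  have eq: "\<bar>b i j\<bar> = \<bar>b 1 (s - 1)\<bar>" if "i \<ge> 1" "j \<ge> 1" "i + j = s" for i j
    using step[of "i - 1"] that by auto
  show ?thesis using eq[OF ij] eq[OF p(1-3)] p(4) by simp
qed

text \<open>On an odd antidiagonal the two middle positions (q + 1, q) and (q, q + 1) are
  neighbours: the recursion makes their entries opposite, symmetry makes them equal.\<close>

lemma odd_antidiagonal_vanishes:
  fixes b :: "nat \<Rightarrow> nat \<Rightarrow> real"
  assumes rec: "\<And>i j. \<lbrakk>i \<ge> 1; j \<ge> 1; Suc (i + j) = s\<rbrakk> \<Longrightarrow> b (Suc i) j = - b i (Suc j)"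
    and sym: "\<And>i j. b i j = b j i" and "odd s"
    and ij: "i \<ge> 1" "j \<ge> 1" "i + j = s"
  shows "b i j = 0"
proof -
  obtain q where q: "s = Suc (q + q)" using \<open>odd s\<close> by (metis oddE mult_2 Suc_eq_plus1)
  then have "q \<ge> 1" using ij by (cases q) auto
  have "b (Suc q) q = - b (Suc q) q" using rec[of q q] \<open>q \<ge> 1\<close> q sym[of q "Suc q"] by simp
  then have "b (Suc q) q = 0" by simp
  then show ?thesis
    using rec ij q \<open>q \<ge> 1\<close> by (intro antidiagonal_vanishes[of s b "Suc q" q i j]) simp_all
qed

context sl2_symplectic_space
begin

text \<open>Extension by zero beyond the basis lets X and Y act by shift formulas without a case
  distinction at the ends.\<close>

definition f0 :: "nat \<Rightarrow> 'v" where "f0 i = (if i \<in> {1..r} then f i else 0)"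

definition entry :: "('v \<Rightarrow>\<^sub>L 'v) \<Rightarrow> nat \<Rightarrow> nat \<Rightarrow> real" where
  "entry A i j = \<sigma> (A (f0 i)) (f0 j)"

lemma X_f0: "i \<ge> 1 \<Longrightarrow> X (f0 i) = f0 (Suc i)"
  by (auto simp: f0_def X_f)

lemma H_f0: "H (f0 i) = (real r + 1 - 2 * real i) *\<^sub>R f0 i"
  by (auto simp: f0_def H_f)

lemma Y_f0: "i \<ge> 1 \<Longrightarrow> Y (f0 i) = ((real i - 1) * (real r + 1 - real i)) *\<^sub>R f0 (i - 1)"
proof (cases "i \<in> {1..r}")
  case False
  assume "i \<ge> 1"
  \<comment> \<open>Either the factor r + 1 - i vanishes, or \<open>f0 (i - 1)\<close> does.\<close>
  then have "i = r + 1 \<or> i - 1 \<notin> {1..r}" using False by auto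
  then show ?thesis using False by (auto simp: f0_def)
qed (auto simp: f0_def Y_f)

lemma entry_sym: "A \<in> S2 \<Longrightarrow> entry A i j = entry A j i"
  unfolding entry_def by (rule S2_D(3))

lemma entry_lie_bracket:
  fixes D :: "'v \<Rightarrow>\<^sub>L 'v"
  assumes "\<And>u v. \<sigma> (D u) v + \<sigma> u (D v) = 0"
  shows "entry (lie_bracket D A) i j = - (\<sigma> (A (D (f0 i))) (f0 j) + \<sigma> (A (f0 i)) (D (f0 j)))"
  using assms[of "A (f0 i)" "f0 j"]
  by (simp add: entry_def lie_bracket_def blinfun.diff_left sigma_simps algebra_simps)

lemma entry_X:
  "i \<ge> 1 \<Longrightarrow> j \<ge> 1 \<Longrightarrow> entry (lie_bracket X A) i j = - (entry A (Suc i) j + entry A i (Suc j))"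
  unfolding entry_lie_bracket[OF skew_X] by (simp add: X_f0 entry_def)

lemma entry_H:
  "entry (lie_bracket H A) i j = (2 * (real i + real j) - 2 * (real r + 1)) * entry A i j"
  unfolding entry_lie_bracket[OF skew_H]
  by (simp only: H_f0 entry_def blinfun.scaleR_right sigma_simps) (simp add: algebra_simps)

lemma entry_Y:
  "i \<ge> 1 \<Longrightarrow> j \<ge> 1 \<Longrightarrow> entry (lie_bracket Y A) i j =
    - ((real i - 1) * (real r + 1 - real i) * entry A (i - 1) j +
       (real j - 1) * (real r + 1 - real j) * entry A i (j - 1))"
  unfolding entry_lie_bracket[OF skew_Y]
  by (simp add: Y_f0 entry_def blinfun.scaleR_right sigma_simps del: One_nat_def)

lemma entry_0: "entry A 0 j = 0" "entry A i 0 = 0"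
  by (simp_all add: entry_def f0_def sigma_simps blinfun.zero_right)

lemma entry_linear: "entry (A + B) i j = entry A i j + entry B i j"
  "entry (A - B) i j = entry A i j - entry B i j"
  "entry (c *\<^sub>R A) i j = c * entry A i j" "entry 0 i j = 0"
  by (simp_all add: entry_def sigma_simps blinfun.bilinear_simps)

lemma entry_weight:
  assumes "lie_bracket H A = w *\<^sub>R A" "entry A i j \<noteq> 0"
  shows "w = 2 * (real i + real j) - 2 * (real r + 1)"
  using entry_H[of A i j] assms by (simp add: entry_linear)

lemma entry_range: "entry A i j \<noteq> 0 \<Longrightarrow> i \<in> {1..r} \<and> j \<in> {1..r}"
  by (auto simp: entry_def f0_def sigma_simps blinfun.zero_right split: if_splits)

definition low_entries_zero :: "nat \<Rightarrow> ('v \<Rightarrow>\<^sub>L 'v) set" where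
  "low_entries_zero N = {A \<in> S2. \<forall>i j. i + j \<le> N \<longrightarrow> entry A i j = 0}"

text \<open>The largest ad X-stable part of \<open>low_entries_zero N\<close>. For
  \<open>N = 2 * k - 1\<close> it will turn out to consist of the quadrics containing the osculating
  (k - 2)-planes.\<close>

definition osculating_annihilator :: "nat \<Rightarrow> ('v \<Rightarrow>\<^sub>L 'v) set" where
  "osculating_annihilator N = {A. \<forall>n. (lie_bracket X ^^ n) A \<in> low_entries_zero N}"

lemma subspace_low_entries_zero: "subspace (low_entries_zero N)"
  using subspace_S2 by (auto simp: low_entries_zero_def subspace_def entry_linear)

lemma low_entries_zero_H: "A \<in> low_entries_zero N \<Longrightarrow> lie_bracket H A \<in> low_entries_zero N"
  by (auto simp: low_entries_zero_def entry_H ad.invariant_S)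

text \<open>An entry of \<open>lie_bracket Y A\<close> involves entries of \<open>A\<close> on the
  preceding antidiagonal only.\<close>

lemma low_entries_zero_Y:
  assumes "A \<in> low_entries_zero N"
  shows "lie_bracket Y A \<in> low_entries_zero N"
proof -
  have "entry (lie_bracket Y A) i j = 0" if "i + j \<le> N" for i j
    using assms that entry_0[of "lie_bracket Y A"] entry_Y[of i j A]
    by (cases "i = 0 \<or> j = 0") (auto simp: low_entries_zero_def)
  then show ?thesis using assms by (auto simp: low_entries_zero_def ad.invariant_S)
qed

lemma linear_ad_funpow: "linear (lie_bracket A ^^ n)"
proof (induction n)
  case (Suc n)
  then show ?case using linear_compose[OF Suc linear_lie_bracket] by (simp add: o_def)
qed (simp add: linear_id[unfolded id_def])

text \<open>Stability under X is built in. For H and Y, one power of X at a time is moved past them: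
  the commutator with H is a multiple of X, and the one with Y is H, so the case of H comes before
  that of Y.\<close>

lemma submodule_osculating_annihilator: "ad.submodule (osculating_annihilator N)"
proof -
  note Z = subspace_low_entries_zero[of N]
  have "subspace (osculating_annihilator N)"
    using Z unfolding subspace_def osculating_annihilator_def
    by (simp add: linear_add[OF linear_ad_funpow] linear_scale[OF linear_ad_funpow] linear_0[OF linear_ad_funpow])
  moreover have X: "lie_bracket X A \<in> osculating_annihilator N" if "A \<in> osculating_annihilator N" for A
    unfolding osculating_annihilator_def
  proof (intro CollectI allI)
    fix n
    have "(lie_bracket X ^^ Suc n) A \<in> low_entries_zero N"
      using that unfolding osculating_annihilator_def by blast
    then show "(lie_bracket X ^^ n) (lie_bracket X A) \<in> low_entries_zero N"
      by (simp only: funpow_Suc_right comp_apply)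
  qed
  have H: "(lie_bracket X ^^ n) (lie_bracket H A) \<in> low_entries_zero N"
    if "A \<in> osculating_annihilator N" for A n
    using that
  proof (induction n arbitrary: A)
    case 0
    then have "(lie_bracket X ^^ 0) A \<in> low_entries_zero N" unfolding osculating_annihilator_def by blast
    then show ?case by (simp add: low_entries_zero_H)
  next
    case (Suc n)
    have "lie_bracket X (lie_bracket H A) = lie_bracket H (lie_bracket X A) + 2 *\<^sub>R lie_bracket X A"
      using ad.hx[of A] by (simp add: algebra_simps)
    then have "(lie_bracket X ^^ Suc n) (lie_bracket H A) =
        (lie_bracket X ^^ n) (lie_bracket H (lie_bracket X A)) + 2 *\<^sub>R (lie_bracket X ^^ n) (lie_bracket X A)"
      by (simp only: funpow_Suc_right comp_apply linear_add[OF linear_ad_funpow] linear_scale[OF linear_ad_funpow])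
    moreover have "(lie_bracket X ^^ n) (lie_bracket X A) \<in> low_entries_zero N"
      using X[OF Suc.prems] unfolding osculating_annihilator_def by blast
    ultimately show ?case
      using Suc.IH[OF X[OF Suc.prems]] Z by (simp only: subspace_add subspace_scale)
  qed
  moreover have "(lie_bracket X ^^ n) (lie_bracket Y A) \<in> low_entries_zero N"
    if "A \<in> osculating_annihilator N" for A n
    using that
  proof (induction n arbitrary: A)
    case 0
    then have "(lie_bracket X ^^ 0) A \<in> low_entries_zero N" unfolding osculating_annihilator_def by blast
    then show ?case by (simp add: low_entries_zero_Y)
  next
    case (Suc n)
    have "lie_bracket X (lie_bracket Y A) = lie_bracket Y (lie_bracket X A) - lie_bracket H A"
      using ad.yx[of A] by (simp add: algebra_simps)
    then have "(lie_bracket X ^^ Suc n) (lie_bracket Y A) =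
        (lie_bracket X ^^ n) (lie_bracket Y (lie_bracket X A)) - (lie_bracket X ^^ n) (lie_bracket H A)"
      by (simp only: funpow_Suc_right comp_apply linear_diff[OF linear_ad_funpow])
    then show ?case
      using Suc.IH[OF X[OF Suc.prems]] H[OF Suc.prems] Z by (simp only: subspace_diff)
  qed
  ultimately show ?thesis
    unfolding ad.submodule_def using X by (simp add: osculating_annihilator_def)
qed

lemma osculating_annihilator_subset: "osculating_annihilator N \<subseteq> low_entries_zero N"
proof
  fix A assume "A \<in> osculating_annihilator N"
  then have "(lie_bracket X ^^ 0) A \<in> low_entries_zero N" unfolding osculating_annihilator_def by blast
  then show "A \<in> low_entries_zero N" by simp
qed

lemma low_entries_zero_S2: "low_entries_zero N \<subseteq> S2"
  by (auto simp: low_entries_zero_def)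

lemma S2_nonzero_entry:
  assumes "A \<in> S2" "A \<noteq> 0"
  obtains i j where "entry A i j \<noteq> 0"
  using S2_eq_0[OF assms(1)] assms(2) by (metis entry_def f0_def)

text \<open>The sum of the weight spaces with weights in [-m, m], expressed through entries:
  position (i, j) carries the weight 2(i + j) - 2(r + 1).\<close>

definition weight_bounded :: "nat \<Rightarrow> ('v \<Rightarrow>\<^sub>L 'v) set" where
  "weight_bounded m = {A \<in> S2. \<forall>i j. entry A i j \<noteq> 0 \<longrightarrow> \<bar>2 * (real i + real j) - 2 * (real r + 1)\<bar> \<le> real m}"

lemma subspace_weight_bounded: "subspace (weight_bounded m)"
  unfolding subspace_def weight_bounded_def
  by (auto simp: entry_linear subspace_0[OF subspace_S2] subspace_add[OF subspace_S2]
      subspace_scale[OF subspace_S2]) (metis add.right_neutral)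

lemma submodule_subset_weight_bounded:
  assumes U: "ad.submodule U" "U \<subseteq> S2" "dim U = Suc m" and "m \<le> M"
  shows "U \<subseteq> weight_bounded M"
proof -
  have "{A \<in> U. \<exists>w. lie_bracket H A = real_of_int w *\<^sub>R A} \<subseteq> weight_bounded M"
  proof clarify
    fix A w assume A: "A \<in> U" "lie_bracket H A = real_of_int w *\<^sub>R A"
    have "\<bar>2 * (real i + real j) - 2 * (real r + 1)\<bar> \<le> real M" if nz: "entry A i j \<noteq> 0" for i j
    proof -
      have "A \<noteq> 0" using nz by (auto simp: entry_linear)
      then have "\<bar>real_of_int w\<bar> \<le> real m" using ad.weight_le_dim[OF U A(1) _ A(2)] by blast
      then show ?thesis unfolding entry_weight[OF A(2) nz] using \<open>m \<le> M\<close> by linarith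
    qed
    then show "A \<in> weight_bounded M" using A(1) U(2) by (auto simp: weight_bounded_def)
  qed
  then have "span {A \<in> U. \<exists>w. lie_bracket H A = real_of_int w *\<^sub>R A} \<subseteq> weight_bounded M"
    by (rule span_minimal[OF _ subspace_weight_bounded])
  then show ?thesis using ad.submodule_span_weight_vectors[OF U(1,2)] by blast
qed

lemma irr_component_sub:
  assumes "\<And>U. U \<subseteq> S2 \<Longrightarrow> ad.submodule U \<Longrightarrow> dim U = Suc m \<Longrightarrow> U \<subseteq> W" "subspace W"
  shows "irr_component r e \<sigma> X H Y m \<subseteq> W"
  unfolding irr_component_def
  by (intro span_minimal assms(2) Union_least) (auto simp: sl2_irreducible_iff ad.irreducible_def dest!: assms(1))

lemma p_module_weight_bounded: "p_module r e \<sigma> X H Y l \<subseteq> weight_bounded (2 * l)"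
  unfolding p_module_def
  by (intro span_minimal subspace_weight_bounded UN_least irr_component_sub submodule_subset_weight_bounded) auto

text \<open>Since r + 1 = 2k + l, a weight of at least -2l at position (i, j) means i + j >= 2k;
  this is the origin of the bound 2k - 1.\<close>

lemma weight_bounded_low_entries_zero:
  assumes "k \<ge> 1" "r + 1 = 2 * k + l"
  shows "weight_bounded (2 * l) \<subseteq> low_entries_zero (2 * k - 1)"
proof
  fix A assume A: "A \<in> weight_bounded (2 * l)"
  have "entry A i j = 0" if "i + j \<le> 2 * k - 1" for i j
  proof (rule ccontr)
    assume "entry A i j \<noteq> 0"
    then have "\<bar>2 * (real i + real j) - 2 * (real r + 1)\<bar> \<le> real (2 * l)"
      using A unfolding weight_bounded_def by blast
    then have "- (2 * (real i + real j) - 2 * (real r + 1)) \<le> 2 * real l"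
      using order_trans[OF abs_ge_minus_self] by simp
    moreover have "real i + real j \<le> 2 * real k - 1" using that assms(1) by linarith
    moreover have "real r + 1 = 2 * real k + real l" using assms(2) by linarith
    ultimately show False by argo
  qed
  then show "A \<in> low_entries_zero (2 * k - 1)" using A by (auto simp: low_entries_zero_def weight_bounded_def)
qed

lemma p_module_eq_osculating_annihilator:
  assumes "k \<ge> 1" "r + 1 = 2 * k + l"
  shows "p_module r e \<sigma> X H Y l = osculating_annihilator (2 * k - 1)"
proof
  have M: "subspace (osculating_annihilator (2 * k - 1))"
    using submodule_osculating_annihilator by (auto simp: ad.submodule_def)
  have "U \<subseteq> osculating_annihilator (2 * k - 1)"
    if U: "U \<subseteq> S2" "ad.submodule U" "dim U = Suc m" "m \<le> 2 * l" for U m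
  proof
    fix A assume "A \<in> U"
    then have "(lie_bracket X ^^ n) A \<in> low_entries_zero (2 * k - 1)" for n
      using ad.submodule_funpow(1)[OF U(2), of A n] submodule_subset_weight_bounded[OF U(2,1,3,4)]
        weight_bounded_low_entries_zero[OF assms] by blast
    then show "A \<in> osculating_annihilator (2 * k - 1)" unfolding osculating_annihilator_def by blast
  qed
  then have "irr_component r e \<sigma> X H Y (2 * l - 4 * j) \<subseteq> osculating_annihilator (2 * k - 1)" for j
    by (intro irr_component_sub M) auto
  then show "p_module r e \<sigma> X H Y l \<subseteq> osculating_annihilator (2 * k - 1)"
    unfolding p_module_def by (intro span_minimal M UN_least)
next
  let ?M = "osculating_annihilator (2 * k - 1)"
  have MS: "?M \<subseteq> S2" using osculating_annihilator_subset low_entries_zero_S2 by blast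
  have "U \<subseteq> p_module r e \<sigma> X H Y l"
    if U: "U \<subseteq> ?M" "ad.irreducible_of_highest_weight n U" for U n
  proof -
    have irr: "sl2_irreducible X H Y U" "dim U = n + 1"
      using U(2) by (auto simp: ad.irreducible_of_highest_weight_def sl2_irreducible_iff)
    obtain A where A: "A \<in> U" "A \<noteq> 0" "lie_bracket X A = 0" "lie_bracket H A = (- real n) *\<^sub>R A"
      using U(2) by (auto simp: ad.irreducible_of_highest_weight_def)
    then have AS: "A \<in> S2" "A \<in> low_entries_zero (2 * k - 1)"
      using U(1) MS osculating_annihilator_subset by blast+
    then obtain i j where nz: "entry A i j \<noteq> 0" using S2_nonzero_entry A(2) by blast
    have ij: "i \<ge> 1" "j \<ge> 1" using entry_range[OF nz] by auto
    have "even (i + j)"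
    proof (rule ccontr)
      assume "odd (i + j)"
      have "entry A (Suc i) j = - entry A i (Suc j)" if "i \<ge> 1" "j \<ge> 1" for i j
        using entry_X[OF that, of A] A(3) by (simp add: entry_linear)
      then have "entry A i j = 0"
        using odd_antidiagonal_vanishes[of "i + j" "entry A" i j] entry_sym[OF AS(1)] \<open>odd (i + j)\<close> ij by blast
      then show False using nz by contradiction
    qed
    then obtain q where q: "i + j = 2 * q" by blast
    have "\<not> i + j \<le> 2 * k - 1" using nz AS(2) by (auto simp: low_entries_zero_def)
    then have "q \<ge> k" using q by auto
    have "- real n = 2 * (real i + real j) - 2 * (real r + 1)" by (rule entry_weight[OF A(4) nz])
    moreover have "real i + real j = 2 * real q" using q by linarith
    moreover have "real r + 1 = 2 * real k + real l" using assms(2) by linarith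
    \<comment> \<open>The weight at i + j = 2q is -n = 4q - 2(2k + l), so the component has index 2l
      - 4(q - k); q >= k makes the subtraction exact.\<close>
    ultimately have "real (n + 4 * (q - k)) = real (2 * l)" using \<open>q \<ge> k\<close> by (simp add: of_nat_diff)
    then have n: "n + 4 * (q - k) = 2 * l" by (simp only: of_nat_eq_iff)
    then have "n = 2 * l - 4 * (q - k)" "4 * (q - k) \<le> 2 * l" by auto
    then have "U \<subseteq> irr_component r e \<sigma> X H Y (2 * l - 4 * (q - k))"
      using irr U(1) MS unfolding irr_component_def by (intro subsetI span_base UnionI[of U]) auto
    also have "\<dots> \<subseteq> p_module r e \<sigma> X H Y l"
      unfolding p_module_def using \<open>4 * (q - k) \<le> 2 * l\<close> by (intro subsetI span_base UN_I[of "q - k"]) auto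
    finally show ?thesis .
  qed
  then have "span (\<Union>{U. U \<subseteq> ?M \<and> (\<exists>n. ad.irreducible_of_highest_weight n U)}) \<subseteq> p_module r e \<sigma> X H Y l"
    by (intro span_minimal Union_least) (auto simp: p_module_def)
  then show "?M \<subseteq> p_module r e \<sigma> X H Y l"
    using ad.submodule_subset_span_irreducibles[OF submodule_osculating_annihilator MS] by blast
qed

end

section \<open>Osculating spaces of the rational normal curve and the quadrics through them\<close>

lemma exp_curve_in_subspace:
  fixes D :: "'v::euclidean_space \<Rightarrow>\<^sub>L 'v"
  assumes "(blinfun_apply D ^^ N) v = 0" "subspace W" "\<And>j. (blinfun_apply D ^^ j) v \<in> W"
  shows "exp_curve D v t \<in> W"
  unfolding exp_curve_nilpotent[OF assms(1)] by (intro subspace_sum subspace_scale assms(2,3))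

lemma osculating_space_exp_curve:
  fixes D :: "'v::euclidean_space \<Rightarrow>\<^sub>L 'v"
  assumes "(blinfun_apply D ^^ N) v = 0"
  shows "osculating_space s (exp_curve D v) t = span ((\<lambda>j. exp_curve D ((blinfun_apply D ^^ j) v) t) ` {..s})"
  unfolding osculating_space_def iterated_derivative_exp_curve[OF assms] ..

context sl2_symplectic_space
begin

lemma quadratic_eq_0_on_span:
  fixes A :: "'v \<Rightarrow>\<^sub>L 'v"
  assumes "\<And>u v. u \<in> B \<Longrightarrow> v \<in> B \<Longrightarrow> \<sigma> (A u) v = 0" "v \<in> span B"
  shows "\<sigma> (A v) v = 0"
proof -
  have "bilinear (\<lambda>u v. \<sigma> (A u) v)" "bilinear (\<lambda>(u::'v) (v::'v). 0::real)"
    by (auto simp: bilinear_def blinfun.bilinear_simps sigma_simps intro!: linearI)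
  then show ?thesis
    by (rule bilinear_eq[of _ _ "span B" B "span B" B]) (use assms in auto)
qed

lemma zariski_closure_superset:
  assumes "S \<subseteq> proj_points Vf"
  shows "S \<subseteq> zariski_closure r e f \<sigma> S"
  using assms by (auto simp: zariski_closure_def vanishing_polys_def)

text \<open>The closure is cut out by the very polynomials that vanish on \<open>S\<close>, so none
  of them is lost; consequently it suffices to test quadrics on the points before closure.\<close>

lemma vanishing_polys_zariski_closure:
  assumes "S \<subseteq> proj_points Vf"
  shows "vanishing_polys r e f \<sigma> m (zariski_closure r e f \<sigma> S) = vanishing_polys r e f \<sigma> m S"
  using zariski_closure_superset[OF assms]
  by (auto simp: zariski_closure_def vanishing_polys_def)

lemma X_funpow_f0: "i \<ge> 1 \<Longrightarrow> (blinfun_apply X ^^ j) (f0 i) = f0 (i + j)"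
  by (induction j) (simp_all add: X_f0)

text \<open>Only the direction matters later, so the coefficient stays existential. Truncated
  subtraction is harmless because \<open>f0 0\<close> is 0.\<close>

lemma Y_funpow_f0: "\<exists>c. (blinfun_apply Y ^^ j) (f0 r) = c *\<^sub>R f0 (r - j)"
proof (induction j)
  case (Suc j)
  then obtain c where c: "(blinfun_apply Y ^^ j) (f0 r) = c *\<^sub>R f0 (r - j)" by blast
  show ?case
  proof (cases "r - j \<ge> 1")
    case True
    then show ?thesis using c Y_f0[OF True] by (auto simp: blinfun.scaleR_right)
  next
    case False
    then have "f0 (r - j) = 0" by (simp add: f0_def)
    then show ?thesis using c by (intro exI[of _ 0]) (simp add: blinfun.zero_right)
  qed
qed (auto intro: exI[of _ 1])

lemma f0_in_Vf: "f0 i \<in> Vf"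
  by (simp add: f0_def span_base span_zero)

lemma X_nilpotent_f0: "i \<ge> 1 \<Longrightarrow> (blinfun_apply X ^^ r) (f0 i) = 0"
  unfolding X_funpow_f0 by (simp add: f0_def)

lemma Y_nilpotent_f0: "(blinfun_apply Y ^^ r) ((blinfun_apply Y ^^ j) (f0 r)) = 0"
proof -
  obtain c where "(blinfun_apply Y ^^ (r + j)) (f0 r) = c *\<^sub>R f0 (r - (r + j))"
    using Y_funpow_f0 by blast
  then show ?thesis by (simp add: funpow_add f0_def)
qed

lemma osculating_space_X:
  "osculating_space s (exp_curve X (f0 1)) t = span ((\<lambda>j. exp_curve X (f0 (1 + j)) t) ` {..s})"
  by (simp only: osculating_space_exp_curve[OF X_nilpotent_f0[OF order_refl]] X_funpow_f0[OF order_refl])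

lemma osculating_space_Y:
  "osculating_space s (exp_curve Y (f0 r)) t =
    span ((\<lambda>j. exp_curve Y ((blinfun_apply Y ^^ j) (f0 r)) t) ` {..s})"
  using Y_nilpotent_f0[of 0] by (intro osculating_space_exp_curve) simp

lemma exp_curve_X_in_Vf: "i \<ge> 1 \<Longrightarrow> exp_curve X (f0 i) t \<in> Vf"
  by (rule exp_curve_in_subspace[OF X_nilpotent_f0]) (simp_all add: X_funpow_f0 f0_in_Vf del: One_nat_def)

lemma exp_curve_Y_in_Vf: "exp_curve Y ((blinfun_apply Y ^^ j) (f0 r)) t \<in> Vf"
proof (rule exp_curve_in_subspace[OF Y_nilpotent_f0])
  fix i
  obtain c where "(blinfun_apply Y ^^ (i + j)) (f0 r) = c *\<^sub>R f0 (r - (i + j))"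
    using Y_funpow_f0 by blast
  then show "(blinfun_apply Y ^^ i) ((blinfun_apply Y ^^ j) (f0 r)) \<in> Vf"
    by (simp add: funpow_add f0_in_Vf span_scale del: One_nat_def)
qed simp

lemma exp_curve_X_nonzero:
  assumes "r \<ge> 1"
  shows "exp_curve X (f0 1) t \<noteq> 0"
proof
  assume "exp_curve X (f0 1) t = 0"
  moreover have "exp_curve X (f0 1) t = (\<Sum>j<r. (t ^ j / fact j) *\<^sub>R f0 (1 + j))"
    by (simp only: exp_curve_nilpotent[OF X_nilpotent_f0[OF order_refl]] X_funpow_f0[OF order_refl])
  \<comment> \<open>Pairing with e_r reads off the coefficient of f_1, which is 1 for every
    \<open>t\<close>.\<close>
  ultimately have "0 = (\<Sum>j<r. \<sigma> (e r) ((t ^ j / fact j) *\<^sub>R f0 (1 + j)))"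
    using linear_sum[OF linear_sigma(1), of "e r" "\<lambda>j. (t ^ j / fact j) *\<^sub>R f0 (1 + j)" "{..<r}"]
    by (simp add: sigma_simps)
  also have "\<dots> = (\<Sum>j<r. if j = 0 then (-1) ^ r else 0)"
    using assms by (intro sum.cong) (auto simp: f0_def sigma_simps \<sigma>_ef)
  also have "\<dots> = (-1) ^ r" using assms by (simp add: sum.delta)
  finally show False by simp
qed

definition developable_points :: "nat \<Rightarrow> 'v set set" where
  "developable_points s =
    (\<Union>P \<in> rational_normal_curve r e f \<sigma> X. \<Union>(osculating_planes_at r f X Y s P))"

lemma developable_points_cases:
  assumes "r \<ge> 1" "L \<in> developable_points s"
  obtains t where "L \<in> proj_points (osculating_space s (exp_curve X (f0 1)) t)"
  | t where "L \<in> proj_points (osculating_space s (exp_curve Y (f0 r)) t)"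
proof -
  have "f 1 = f0 1" "f r = f0 r" using assms(1) by (auto simp: f0_def)
  then show ?thesis
    using assms(2) that unfolding developable_points_def osculating_planes_at_def by auto
qed

lemma osculating_points_subset:
  assumes "r \<ge> 1"
  shows "proj_points (osculating_space s (exp_curve X (f0 1)) t) \<subseteq> developable_points s"
proof -
  have f1: "f 1 = f0 1" using assms by (auto simp: f0_def)
  have "{span {exp_curve X (f 1) t} | t. True} \<subseteq> proj_points Vf"
    using exp_curve_X_in_Vf[OF order_refl] exp_curve_X_nonzero[OF assms] unfolding proj_points_def f1 by blast
  then have "span {exp_curve X (f 1) t} \<in> rational_normal_curve r e f \<sigma> X"
    unfolding rational_normal_curve_def using zariski_closure_superset by blast
  moreover have "proj_points (osculating_space s (exp_curve X (f0 1)) t) \<in>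
      osculating_planes_at r f X Y s (span {exp_curve X (f 1) t})"
    unfolding osculating_planes_at_def f1[symmetric] by blast
  ultimately show ?thesis unfolding developable_points_def by blast
qed

lemma proj_points_mono: "W \<subseteq> W' \<Longrightarrow> proj_points W \<subseteq> proj_points W'"
  by (auto simp: proj_points_def)

lemma osculating_space_subset_Vf:
  "osculating_space s (exp_curve X (f0 1)) t \<subseteq> Vf" "osculating_space s (exp_curve Y (f0 r)) t \<subseteq> Vf"
  unfolding osculating_space_X osculating_space_Y
  by (intro span_minimal subspace_span; use exp_curve_X_in_Vf exp_curve_Y_in_Vf in auto)+

lemma developable_points_subset:
  assumes "r \<ge> 1"
  shows "developable_points s \<subseteq> proj_points Vf"
proof
  fix L assume "L \<in> developable_points s"
  then show "L \<in> proj_points Vf"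
    by (cases rule: developable_points_cases[OF assms, consumes 1])
      (rule subsetD[OF proj_points_mono[OF osculating_space_subset_Vf(1)]], assumption,
       rule subsetD[OF proj_points_mono[OF osculating_space_subset_Vf(2)]], assumption)
qed

lemma proj_point_subset:
  assumes "subspace W" "L \<in> proj_points W"
  shows "L \<subseteq> W"
  using assms span_minimal[of "{_}" W] by (auto simp: proj_points_def)

text \<open>Along exp(tX) the planes are spanned by curves starting at f_1, ..., f_{k-1}, where the
  low entries vanish. Along exp(tY) they start at multiples of f_r, ..., f_{r-k+2}, where the
  entries would have too high a weight.\<close>

lemma p_module_vanishes_on_osculating_space:
  assumes "k \<ge> 2" "r + 1 = 2 * k + l" and A: "A \<in> p_module r e \<sigma> X H Y l"
    and v: "v \<in> osculating_space (k - 2) (exp_curve X (f0 1)) t \<or>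
            v \<in> osculating_space (k - 2) (exp_curve Y (f0 r)) t"
  shows "\<sigma> (A v) v = 0"
proof -
  have p_eq: "p_module r e \<sigma> X H Y l = osculating_annihilator (2 * k - 1)"
    using assms by (intro p_module_eq_osculating_annihilator) auto
  have sub: "ad.submodule (p_module r e \<sigma> X H Y l)"
    unfolding p_eq by (rule submodule_osculating_annihilator)
  have AS: "A \<in> S2" using A p_module_weight_bounded by (auto simp: weight_bounded_def)
  have "\<sigma> (A (exp_curve X (f0 (1 + i)) t)) (exp_curve X (f0 (1 + j)) t) = 0"
    if "i \<le> k - 2" "j \<le> k - 2" for i j
  proof (rule bilinear_exp_curve_eq_0[OF \<sigma>_bilinear skew_X])
    show "(lie_bracket X ^^ Suc (2 * r)) A = 0" by (rule ad.nilpotent_x[OF AS])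
    have "(1 + i) + (1 + j) \<le> 2 * k - 1" using that assms(1) by linarith
    then show "\<sigma> ((lie_bracket X ^^ n) A (f0 (1 + i))) (f0 (1 + j)) = 0" for n
      using ad.submodule_funpow(1)[OF sub A, of n] osculating_annihilator_subset[of "2 * k - 1"]
      unfolding p_eq low_entries_zero_def entry_def[symmetric] by blast
  qed (rule X_nilpotent_f0, simp)+
  moreover have "\<sigma> (A (exp_curve Y ((blinfun_apply Y ^^ i) (f0 r)) t)) (exp_curve Y ((blinfun_apply Y ^^ j) (f0 r)) t) = 0"
    if ij: "i \<le> k - 2" "j \<le> k - 2" for i j
  proof (rule bilinear_exp_curve_eq_0[OF \<sigma>_bilinear skew_Y Y_nilpotent_f0 Y_nilpotent_f0])
    show "(lie_bracket Y ^^ Suc (2 * r)) A = 0" by (rule sl2_module.nilpotent_x[OF ad.dual AS])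
    fix n
    obtain c d where c: "(blinfun_apply Y ^^ i) (f0 r) = c *\<^sub>R f0 (r - i)" "(blinfun_apply Y ^^ j) (f0 r) = d *\<^sub>R f0 (r - j)"
      using Y_funpow_f0 by blast
    have "entry ((lie_bracket Y ^^ n) A) (r - i) (r - j) = 0"
    proof (rule ccontr)
      assume "entry ((lie_bracket Y ^^ n) A) (r - i) (r - j) \<noteq> 0"
      then have "\<bar>2 * (real (r - i) + real (r - j)) - 2 * (real r + 1)\<bar> \<le> real (2 * l)"
        using ad.submodule_funpow(2)[OF sub A, of n] p_module_weight_bounded
        unfolding weight_bounded_def by blast
      \<comment> \<open>For i, j <= k - 2 the weight on the left is at least 2l + 4, beyond the
        upper bound.\<close>
      then have "2 * (real (r - i) + real (r - j)) - 2 * (real r + 1) \<le> 2 * real l"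
        using order_trans[OF abs_ge_self] by simp
      moreover have "real (r - i) = real r - real i" "real (r - j) = real r - real j"
        using ij assms(1,2) by (auto simp: of_nat_diff)
      moreover have "real i \<le> real k - 2" "real j \<le> real k - 2" using ij assms(1) by linarith+
      moreover have "real r + 1 = 2 * real k + real l" using assms(2) by linarith
      ultimately show False by argo
    qed
    then show "\<sigma> ((lie_bracket Y ^^ n) A ((blinfun_apply Y ^^ i) (f0 r))) ((blinfun_apply Y ^^ j) (f0 r)) = 0"
      by (simp add: c blinfun.scaleR_right sigma_simps entry_def)
  qed
  ultimately show ?thesis
    using v unfolding osculating_space_X osculating_space_Y by (elim disjE quadratic_eq_0_on_span[rotated]) auto
qed

text \<open>Differentiating the identity along exp(tX) replaces \<open>A\<close> by its brackets
  with X; evaluation at \<open>t = 0\<close> then gives a square of zero entries for each of them,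
  which is enlarged to the triangle antidiagonal by antidiagonal.\<close>

lemma vanishing_on_osculating_spaces_imp_p_module:
  assumes "k \<ge> 2" "r + 1 = 2 * k + l" and A: "A \<in> S2"
    and Q: "\<And>t v. v \<in> osculating_space (k - 2) (exp_curve X (f0 1)) t \<Longrightarrow> \<sigma> (A v) v = 0"
  shows "A \<in> p_module r e \<sigma> X H Y l"
proof -
  let ?\<gamma> = "\<lambda>i. exp_curve X (f0 (1 + i))"
  have X_n: "(lie_bracket X ^^ n) A \<in> S2" for n
    by (rule ad.submodule_funpow(1)[OF ad.submodule_S A])
  have "\<sigma> ((lie_bracket X ^^ n) A (?\<gamma> i t)) (?\<gamma> j t) = 0" if ij: "i \<le> k - 2" "j \<le> k - 2" for n i j t
  proof (induction n arbitrary: t)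
    case 0
    have \<gamma>: "?\<gamma> i t \<in> osculating_space (k - 2) (exp_curve X (f0 1)) t"
      "?\<gamma> j t \<in> osculating_space (k - 2) (exp_curve X (f0 1)) t"
      using ij unfolding osculating_space_X by (auto intro!: span_base)
    \<comment> \<open>Polarisation: the quadric also vanishes at the sum of two vectors of the
      osculating space.\<close>
    then have "?\<gamma> i t + ?\<gamma> j t \<in> osculating_space (k - 2) (exp_curve X (f0 1)) t"
      unfolding osculating_space_X by (rule span_add)
    then show ?case
      using Q[OF \<gamma>(1)] Q[OF \<gamma>(2)] Q[of "?\<gamma> i t + ?\<gamma> j t" t] S2_D(3)[OF A, of "?\<gamma> i t" "?\<gamma> j t"]
      by (simp add: blinfun.add_right sigma_simps)
  next
    case (Suc n)
    have "((\<lambda>t. \<sigma> ((lie_bracket X ^^ n) A (?\<gamma> i t)) (?\<gamma> j t)) has_vector_derivative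
        - \<sigma> (lie_bracket X ((lie_bracket X ^^ n) A) (?\<gamma> i t)) (?\<gamma> j t)) (at t)"
      by (rule has_vector_derivative_bilinear_exp_curve[OF \<sigma>_bilinear skew_X X_nilpotent_f0 X_nilpotent_f0]) auto
    \<comment> \<open>The induction hypothesis holds for every \<open>t\<close>, so the
      differentiated function is identically zero.\<close>
    then have "((\<lambda>t. 0) has_vector_derivative
        - \<sigma> (lie_bracket X ((lie_bracket X ^^ n) A) (?\<gamma> i t)) (?\<gamma> j t)) (at t)"
      by (simp only: Suc.IH)
    then show ?case
      using vector_derivative_unique_at[OF _ has_vector_derivative_const] by fastforce
  qed
  from this[of _ _ _ 0] have zero: "entry ((lie_bracket X ^^ n) A) (1 + i) (1 + j) = 0"
    if "i \<le> k - 2" "j \<le> k - 2" for n i j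
    using that exp_curve_0[OF X_nilpotent_f0] by (simp add: entry_def)
  \<comment> \<open>All \<open>n\<close> are treated together, because the recursion on antidiagonal
    s + 1 for power \<open>n\<close> uses antidiagonal s for power \<open>n + 1\<close>.\<close>
  have "\<forall>n i j. i + j = s \<longrightarrow> entry ((lie_bracket X ^^ n) A) i j = 0" if "s \<le> 2 * k - 1" for s
    using that
  proof (induction s)
    case 0
    then show ?case by (simp add: entry_0)
  next
    case (Suc s)
    have rec: "entry ((lie_bracket X ^^ n) A) (Suc i) j = - entry ((lie_bracket X ^^ n) A) i (Suc j)"
      if "i \<ge> 1" "j \<ge> 1" "Suc (i + j) = Suc s" for n i j
    proof -
      have "i + j = s" "s \<le> 2 * k - 1" using Suc.prems that(3) by auto
      then have "entry ((lie_bracket X ^^ Suc n) A) i j = 0" using Suc.IH by blast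
      then show ?thesis using entry_X[OF that(1,2), of "(lie_bracket X ^^ n) A"] by simp
    qed
    have "entry ((lie_bracket X ^^ n) A) i j = 0" if ij: "i + j = Suc s" "i \<ge> 1" "j \<ge> 1" for n i j
    proof (cases "odd (Suc s)")
      case True
      show ?thesis
        using True ij
        by (intro odd_antidiagonal_vanishes[of "Suc s" "entry ((lie_bracket X ^^ n) A)" i j] rec entry_sym[OF X_n])
    next
      case False
      then obtain q where q: "Suc s = 2 * q" by blast
      \<comment> \<open>An even number up to 2k - 1 is at most 2k - 2, so the diagonal position (q,
        q) lies in the square already known to vanish.\<close>
      have q': "q \<ge> 1" "q - 1 \<le> k - 2" using q Suc.prems by auto
      then have "entry ((lie_bracket X ^^ n) A) q q = 0" using zero[of "q - 1" "q - 1" n] by simp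
      then show ?thesis
        using ij q q'(1)
        by (intro antidiagonal_vanishes[of "Suc s" "entry ((lie_bracket X ^^ n) A)" q q i j] rec) simp_all
    qed
    moreover have "entry ((lie_bracket X ^^ n) A) i j = 0" if "\<not> (i \<ge> 1 \<and> j \<ge> 1)" for n i j
      using that entry_0 by (cases "i = 0"; cases "j = 0") auto
    ultimately show ?case by blast
  qed
  then have "(lie_bracket X ^^ n) A \<in> low_entries_zero (2 * k - 1)" for n
    using X_n by (auto simp: low_entries_zero_def)
  then have "A \<in> osculating_annihilator (2 * k - 1)" by (simp add: osculating_annihilator_def)
  then show ?thesis using p_module_eq_osculating_annihilator[of k l] assms(1,2) by simp
qed

lemma tangential_developable_eq:
  "tangential_developable r e f \<sigma> X Y s = zariski_closure r e f \<sigma> (developable_points s)"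
  by (simp add: tangential_developable_def developable_points_def)

lemma bij_betw_quadratic_poly:
  assumes k: "k \<ge> 2" "r + 1 = 2 * k + l"
  shows "bij_betw (quadratic_poly r f \<sigma>) (p_module r e \<sigma> X H Y l)
    (vanishing_polys r e f \<sigma> 2 (tangential_developable r e f \<sigma> X Y (k - 2)))"
proof -
  have r: "r \<ge> 1" using k by linarith
  have pS: "p_module r e \<sigma> X H Y l \<subseteq> S2"
    using p_module_weight_bounded by (auto simp: weight_bounded_def)
  have V: "vanishing_polys r e f \<sigma> 2 (tangential_developable r e f \<sigma> X Y (k - 2)) =
      vanishing_polys r e f \<sigma> 2 (developable_points (k - 2))"
    unfolding tangential_developable_eq
    by (rule vanishing_polys_zariski_closure[OF developable_points_subset[OF r]])
  have "quadratic_poly r f \<sigma> A v = 0"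
    if A: "A \<in> p_module r e \<sigma> X H Y l" and L: "L \<in> developable_points (k - 2)" "v \<in> L" for A L v
  proof -
    have "v \<in> Vf" using proj_point_subset[OF subspace_span] developable_points_subset[OF r] L by blast
    moreover have "\<sigma> (A v) v = 0"
      using L(1)
    proof (cases rule: developable_points_cases[OF r, consumes 1])
      case (1 t)
      then have "L \<subseteq> osculating_space (k - 2) (exp_curve X (f0 1)) t"
        by (intro proj_point_subset) (auto simp: osculating_space_def)
      then show ?thesis using p_module_vanishes_on_osculating_space[OF k A] L(2) by blast
    next
      case (2 t)
      then have "L \<subseteq> osculating_space (k - 2) (exp_curve Y (f0 r)) t"
        by (intro proj_point_subset) (auto simp: osculating_space_def)
      then show ?thesis using p_module_vanishes_on_osculating_space[OF k A] L(2) by blast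
    qed
    ultimately show ?thesis by (simp add: quadratic_poly_def)
  qed
  then have "quadratic_poly r f \<sigma> ` p_module r e \<sigma> X H Y l \<subseteq> vanishing_polys r e f \<sigma> 2 (developable_points (k - 2))"
    using quadratic_poly_in_hom_polys by (auto simp: vanishing_polys_def)
  moreover have "F \<in> quadratic_poly r f \<sigma> ` p_module r e \<sigma> X H Y l"
    if F: "F \<in> vanishing_polys r e f \<sigma> 2 (developable_points (k - 2))" for F
  proof -
    have "F \<in> hom_polys r e f \<sigma> 2" using F by (simp add: vanishing_polys_def)
    then obtain A where A: "A \<in> S2" "F = quadratic_poly r f \<sigma> A"
      by (rule hom_polys_2_quadratic_poly) (simp add: S2_eq_span)
    have "\<sigma> (A v) v = 0" if v: "v \<in> osculating_space (k - 2) (exp_curve X (f0 1)) t" for v t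
    proof (cases "v = 0")
      case False
      then have "span {v} \<in> developable_points (k - 2)"
        using v osculating_points_subset[OF r, of "k - 2" t] by (auto simp: proj_points_def)
      moreover have "v \<in> span {v}" by (simp add: span_base)
      ultimately have "F v = 0" using F unfolding vanishing_polys_def by blast
      moreover have "v \<in> Vf" using v osculating_space_subset_Vf(1) by blast
      ultimately show ?thesis by (simp add: A(2) quadratic_poly_def)
    qed (simp add: sigma_simps)
    then have "A \<in> p_module r e \<sigma> X H Y l"
      by (rule vanishing_on_osculating_spaces_imp_p_module[OF k A(1)])
    then show ?thesis using A(2) by blast
  qed
  ultimately show ?thesis
    unfolding V bij_betw_def using inj_on_subset[OF inj_on_quadratic_poly pS] by blast
qed

section \<open>Prolongations and secant varieties\<close>

definition prolongation_form :: "('v list \<Rightarrow> 'v) \<Rightarrow> 'v list \<Rightarrow> real" where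
  "prolongation_form \<phi> vs = \<sigma> (\<phi> (butlast vs)) (last vs)"

lemma prolongation_form_Cons:
  "vs \<noteq> [] \<Longrightarrow> prolongation_form \<phi> (v # vs) = prolongation_form (\<lambda>us. \<phi> (v # us)) vs"
  by (simp add: prolongation_form_def)

text \<open>The swap condition exchanges the first two slots at each level and membership in
  \<open>S2\<close> the last two. If the heads differ, the tail is permuted to bring the other head
  to second place, the two are swapped, and the tail is permuted again.\<close>

lemma prolongation_form_permute:
  fixes \<pp> :: "('v \<Rightarrow>\<^sub>L 'v) set"
  assumes "\<pp> \<subseteq> S2" "\<phi> \<in> prolongation \<pp> n" "length vs = n + 2" "mset vs = mset ws"
  shows "prolongation_form \<phi> vs = prolongation_form \<phi> ws"
  using assms(2-)
proof (induction n arbitrary: \<phi> vs ws)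
  case 0
  then obtain A where A: "A \<in> S2" "\<phi> = (\<lambda>vs. if length vs = 1 then A (hd vs) else 0)"
    using assms(1) by auto
  have "length ws = 2" using 0 mset_eq_length by fastforce
  then obtain a b c d where "vs = [a, b]" "ws = [c, d]"
    using 0(2) by (auto simp: length_Suc_conv numeral_2_eq_2)
  then show ?case
    using 0(3) S2_D(3)[OF A(1)] by (auto simp: A(2) prolongation_form_def add_eq_conv_ex)
next
  case (Suc n)
  obtain a vs' where vs: "vs = a # vs'" using Suc.prems(2) by (cases vs) auto
  obtain b ws' where ws: "ws = b # ws'" using Suc.prems(3) vs by (cases ws) auto
  have len: "length vs' = n + 2" "length ws' = n + 2"
    using Suc.prems(2) mset_eq_length[OF Suc.prems(3)] by (auto simp: vs ws)
  then have ne: "vs' \<noteq> []" "ws' \<noteq> []" by auto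
  have \<phi>: "(\<lambda>us. \<phi> (u # us)) \<in> prolongation \<pp> n" for u using Suc.prems(1) by auto
  show ?case
  proof (cases "a = b")
    case True
    then show ?thesis
      using Suc.IH[OF \<phi> len(1), of ws'] Suc.prems(3) ne by (simp add: vs ws prolongation_form_Cons)
  next
    case False
    define zs where "zs = remove1 b vs'"
    have "b \<in># mset vs'"
      using Suc.prems(3) False by (metis insert_noteq_member mset.simps(2) vs ws)
    then have vs': "mset vs' = mset (b # zs)" by (simp add: zs_def)
    then have ws': "mset ws' = mset (a # zs)" using Suc.prems(3) by (simp add: vs ws add_mset_commute)
    have "zs \<noteq> []" using mset_eq_length[OF vs'] len by auto
    have "prolongation_form \<phi> vs = prolongation_form \<phi> (a # b # zs)"
      using Suc.IH[OF \<phi> len(1) vs', of a] ne by (simp add: vs prolongation_form_Cons)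
    also have "\<dots> = prolongation_form \<phi> (b # a # zs)"
      using Suc.prems(1) \<open>zs \<noteq> []\<close> by (auto simp: prolongation_form_def)
    also have "\<dots> = prolongation_form \<phi> ws"
      using Suc.IH[OF \<phi> len(2) ws', of b] ne by (simp add: ws prolongation_form_Cons)
    finally show ?thesis .
  qed
qed

text \<open>Filling the first n slots descends to the 0-th prolongation and leaves a single
  endomorphism from the given space, evaluated as a quadric at \<open>w\<close>.\<close>

lemma prolongation_form_double:
  fixes \<pp> :: "('v \<Rightarrow>\<^sub>L 'v) set"
  assumes "\<And>A. A \<in> \<pp> \<Longrightarrow> \<sigma> (A w) w = 0" "\<phi> \<in> prolongation \<pp> n" "length us = n"
  shows "prolongation_form \<phi> (us @ [w, w]) = 0"
  using assms(2-)
proof (induction n arbitrary: \<phi> us)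
  case 0
  then show ?case using assms(1) by (auto simp: prolongation_form_def)
next
  case (Suc n)
  then obtain u us' where us: "us = u # us'" "length us' = n" by (auto simp: length_Suc_conv)
  have "(\<lambda>vs. \<phi> (u # vs)) \<in> prolongation \<pp> n" using Suc.prems(1) by auto
  then show ?case using Suc.IH[OF _ us(2)] by (simp add: us prolongation_form_Cons)
qed

lemma prolongation_form_not_distinct:
  fixes \<pp> :: "('v \<Rightarrow>\<^sub>L 'v) set"
  assumes \<pp>: "\<pp> \<subseteq> S2" and Q: "\<And>A w. A \<in> \<pp> \<Longrightarrow> w \<in> set vs \<Longrightarrow> \<sigma> (A w) w = 0"
    and "\<phi> \<in> prolongation \<pp> n" "length vs = n + 2" "\<not> distinct vs"
  shows "prolongation_form \<phi> vs = 0"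
proof -
  obtain as bs cs w where vs: "vs = as @ [w] @ bs @ [w] @ cs"
    using not_distinct_decomp[OF assms(5)] by blast
  have "prolongation_form \<phi> vs = prolongation_form \<phi> ((as @ bs @ cs) @ [w, w])"
    using assms(4) by (intro prolongation_form_permute[OF \<pp> assms(3)]) (auto simp: vs)
  also have "\<dots> = 0"
    using assms(4) Q by (intro prolongation_form_double[OF _ assms(3)]) (auto simp: vs)
  finally show ?thesis .
qed

lemma linear_prolongation_form_Cons:
  fixes \<pp> :: "('v \<Rightarrow>\<^sub>L 'v) set"
  assumes "\<phi> \<in> prolongation \<pp> n" "vs \<noteq> []"
  shows "linear (\<lambda>v. prolongation_form \<phi> (v # vs))"
proof -
  have "linear (\<lambda>v. \<phi> (v # butlast vs))"
  proof (cases n)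
    case 0
    then obtain A :: "'v \<Rightarrow>\<^sub>L 'v" where "\<phi> = (\<lambda>vs. if length vs = 1 then A (hd vs) else 0)"
      using assms(1) by auto
    then show ?thesis
      \<comment> \<open>For a longer list the length guard of the 0-th prolongation makes the map
        zero.\<close>
      by (cases "butlast vs = []") (auto intro!: linearI simp: blinfun.bilinear_simps)
  qed (use assms(1) in auto)
  from linear_compose[OF this linear_sigma(2)] show ?thesis
    using assms(2) by (simp add: prolongation_form_def o_def)
qed

text \<open>Expanding all arguments over \<open>W\<close>, every term repeats an element of \<open>W\<close> by the pigeonhole
  principle, and by symmetry the repeated element can be moved to the last two slots.\<close>

lemma prolongation_form_span_eq_0:
  fixes \<pp> :: "('v \<Rightarrow>\<^sub>L 'v) set"
  assumes \<pp>: "\<pp> \<subseteq> S2" and Q: "\<And>A w. A \<in> \<pp> \<Longrightarrow> w \<in> W \<Longrightarrow> \<sigma> (A w) w = 0"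
    and \<phi>: "\<phi> \<in> prolongation \<pp> n" and W: "finite W" "card W \<le> n + 1" and v: "v \<in> span W"
  shows "prolongation_form \<phi> (replicate (n + 2) v) = 0"
proof -
  have "prolongation_form \<phi> (xs @ replicate q v) = 0" if "set xs \<subseteq> W" "length xs + q = n + 2" for xs q
    using that
  proof (induction q arbitrary: xs)
    case 0
    have "card (set xs) < length xs" using card_mono[OF W(1) 0(1)] W(2) 0(2) by linarith
    then have "\<not> distinct xs" using distinct_card by fastforce
    then show ?case
      using prolongation_form_not_distinct[OF \<pp> _ \<phi>, of xs] Q 0 by auto
  next
    case (Suc q)
    let ?zs = "xs @ replicate q v"
    have zs: "?zs \<noteq> []" using Suc.prems(2) by auto
    have "prolongation_form \<phi> (xs @ replicate (Suc q) v) = prolongation_form \<phi> (v # ?zs)"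
      using Suc.prems(2) by (intro prolongation_form_permute[OF \<pp> \<phi>]) auto
    also have "\<dots> = 0"
    proof -
      note linear = linear_prolongation_form_Cons[OF \<phi> zs]
      have "W \<subseteq> {a. prolongation_form \<phi> (a # ?zs) = 0}"
        using Suc.IH[of "_ # xs"] Suc.prems by auto
      then have "span W \<subseteq> {a. prolongation_form \<phi> (a # ?zs) = 0}"
        by (rule span_minimal[OF _ linear_subspace_kernel[OF linear]])
      then show ?thesis using v by blast
    qed
    finally show ?case .
  qed
  from this[of "[]" "n + 2"] show ?thesis by simp
qed

lemma prolongation_poly_eq_form:
  "v \<in> Vf \<Longrightarrow> prolongation_poly r f \<sigma> n \<phi> v = prolongation_form \<phi> (replicate (n + 2) v)"
proof -
  have "replicate (n + 2) v = replicate (n + 1) v @ [v]" for v :: 'v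
    by (simp add: replicate_append_same)
  then show "v \<in> Vf \<Longrightarrow> ?thesis"
    unfolding prolongation_poly_def prolongation_form_def by simp
qed

text \<open>Expanding only the first argument by \<open>Vf_expansion\<close> gives coordinates times
  polynomials of elements one prolongation lower, so the degree grows by one.\<close>

lemma prolongation_poly_in_hom_polys:
  fixes \<pp> :: "('v \<Rightarrow>\<^sub>L 'v) set"
  assumes "\<phi> \<in> prolongation \<pp> n"
  shows "prolongation_poly r f \<sigma> n \<phi> \<in> hom_polys r e f \<sigma> (n + 2)"
  using assms
proof (induction n arbitrary: \<phi>)
  case 0
  then obtain A :: "'v \<Rightarrow>\<^sub>L 'v" where "\<phi> = (\<lambda>vs. if length vs = 1 then A (hd vs) else 0)" by auto
  then have "prolongation_poly r f \<sigma> 0 \<phi> = quadratic_poly r f \<sigma> A"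
    by (simp add: prolongation_poly_def quadratic_poly_def)
  then show ?case using quadratic_poly_in_hom_polys by (simp add: numeral_2_eq_2)
next
  case (Suc n)
  let ?F = "\<lambda>i. prolongation_poly r f \<sigma> n (\<lambda>vs. \<phi> (f (r + 1 - i) # vs))"
  have "(\<lambda>v \<in> Vf. \<Sum>i=1..r. (-1) ^ i * (\<lambda>v \<in> Vf. \<sigma> (e i) v * ?F i v) v) \<in> hom_polys r e f \<sigma> (Suc (n + 2))"
    using Suc.prems by (intro hom_polys_sum hom_polys_coord_mult Suc.IH) auto
  also have "(\<lambda>v \<in> Vf. \<Sum>i=1..r. (-1) ^ i * (\<lambda>v \<in> Vf. \<sigma> (e i) v * ?F i v) v) = prolongation_poly r f \<sigma> (Suc n) \<phi>"
    unfolding prolongation_poly_def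
  proof (rule restrict_ext)
    fix v assume v: "v \<in> Vf"
    let ?vs = "replicate (n + 1) v"
    have lin: "linear (\<lambda>u. \<phi> (u # ?vs))" using Suc.prems by auto
    have "\<phi> (v # ?vs) = (\<Sum>i=1..r. ((-1) ^ i * \<sigma> (e i) v) *\<^sub>R \<phi> (f (r + 1 - i) # ?vs))"
      using arg_cong[OF Vf_expansion[OF v], of "\<lambda>u. \<phi> (u # ?vs)"]
      by (simp only: linear_sum[OF lin] linear_scale[OF lin])
    then have "\<sigma> (\<phi> (v # ?vs)) v = (\<Sum>i=1..r. \<sigma> (((-1) ^ i * \<sigma> (e i) v) *\<^sub>R \<phi> (f (r + 1 - i) # ?vs)) v)"
      by (simp only: linear_sum[OF linear_sigma(2)])
    then show "(\<Sum>i=1..r. (-1) ^ i * (\<lambda>v \<in> Vf. \<sigma> (e i) v *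
        (\<lambda>v \<in> Vf. \<sigma> (\<phi> (f (r + 1 - i) # replicate (n + 1) v)) v) v) v) = \<sigma> (\<phi> (replicate (Suc n + 1) v)) v"
      using v by (simp add: sigma_simps mult.assoc)
  qed
  finally show ?case by simp
qed

lemma prolongation_poly_vanishes_on_secant_variety:
  fixes \<pp> :: "('v \<Rightarrow>\<^sub>L 'v) set"
  assumes \<pp>: "\<pp> \<subseteq> S2" and V: "V \<subseteq> proj_points Vf"
    and Q: "\<And>A. A \<in> \<pp> \<Longrightarrow> quadratic_poly r f \<sigma> A \<in> vanishing_polys r e f \<sigma> 2 V"
    and \<phi>: "\<phi> \<in> prolongation \<pp> n"
  shows "prolongation_poly r f \<sigma> n \<phi> \<in> vanishing_polys r e f \<sigma> (n + 2) (secant_variety r e f \<sigma> (n + 1) V)"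
proof -
  let ?F = "prolongation_poly r f \<sigma> n \<phi>"
  let ?U = "\<Union>p \<in> {..<n + 1} \<rightarrow>\<^sub>E V. proj_points (span (\<Union>i<n + 1. p i))"
  have hom: "?F \<in> hom_polys r e f \<sigma> (n + 2)" by (rule prolongation_poly_in_hom_polys[OF \<phi>])
  have "?F v = 0" if p: "p \<in> {..<n + 1} \<rightarrow>\<^sub>E V" and L: "L \<in> proj_points (span (\<Union>i<n + 1. p i))" "v \<in> L" for p L v
  proof -
    have "\<exists>u. u \<in> Vf \<and> p i = span {u}" if "i < n + 1" for i
      using p V that by (auto simp: proj_points_def PiE_iff)
    then obtain u where u: "\<And>i. i < n + 1 \<Longrightarrow> u i \<in> Vf \<and> p i = span {u i}" by metis
    let ?W = "u ` {..<n + 1}"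
    have "p i \<subseteq> span ?W" if "i < n + 1" for i
      using u[OF that] span_mono[of "{u i}" ?W] that by simp
    then have "span (\<Union>i<n + 1. p i) \<subseteq> span ?W" by (intro span_minimal subspace_span) auto
    then have v: "v \<in> span ?W" using proj_point_subset[OF subspace_span L(1)] L(2) by blast
    have "?W \<subseteq> Vf" using u by auto
    then have "v \<in> Vf" using span_minimal[OF _ subspace_span] v by blast
    have "\<sigma> (A (u i)) (u i) = 0" if "A \<in> \<pp>" "i < n + 1" for A i
    proof -
      have "p i \<in> V" using p \<open>i < n + 1\<close> by auto
      moreover have "u i \<in> p i" using u[OF \<open>i < n + 1\<close>] by (simp add: span_base)
      ultimately have "quadratic_poly r f \<sigma> A (u i) = 0"
        using Q[OF \<open>A \<in> \<pp>\<close>] unfolding vanishing_polys_def by blast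
      then show ?thesis using u[OF \<open>i < n + 1\<close>] by (simp add: quadratic_poly_def)
    qed
    \<comment> \<open>The chosen points may coincide; their representatives still form a set of at
      most n + 1 vectors, one fewer than the slots of the form.\<close>
    then have "prolongation_form \<phi> (replicate (n + 2) v) = 0"
      using card_image_le[of "{..<n + 1}" u] by (intro prolongation_form_span_eq_0[OF \<pp> _ \<phi> _ _ v]) auto
    then show ?thesis using prolongation_poly_eq_form[OF \<open>v \<in> Vf\<close>] by simp
  qed
  then have "?F \<in> vanishing_polys r e f \<sigma> (n + 2) ?U"
    using hom by (auto simp: vanishing_polys_def simp del: Un_iff)
  \<comment> \<open>The polynomial is itself one of those defining the closure, so it vanishes there
    as well.\<close>
  then show ?thesis
    using hom by (auto simp: secant_variety_def zariski_closure_def vanishing_polys_def)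
qed

end

theorem theorem4:
  fixes k l r :: nat
    and e f :: "nat \<Rightarrow> 'v::euclidean_space"
    and \<sigma> :: "'v \<Rightarrow> 'v \<Rightarrow> real"
    and X H Y :: "'v \<Rightarrow>\<^sub>L 'v"
  assumes "k \<ge> 2" and "l > 0" and "r = 2 * k + l - 1"
    and "sl2_symplectic_space r e f \<sigma> X H Y"
  shows "bij_betw (quadratic_poly r f \<sigma>) (p_module r e \<sigma> X H Y l)
           (vanishing_polys r e f \<sigma> 2 (tangential_developable r e f \<sigma> X Y (k - 2))) \<and>
         (\<forall>n. prolongation_poly r f \<sigma> n ` prolongation (p_module r e \<sigma> X H Y l) n
           \<subseteq> vanishing_polys r e f \<sigma> (n + 2)
               (secant_variety r e f \<sigma> (n + 1) (tangential_developable r e f \<sigma> X Y (k - 2))))"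
proof -
  interpret sl2_symplectic_space r e f \<sigma> X H Y by fact
  have r: "r + 1 = 2 * k + l" using assms(1,3) by simp
  note bij = bij_betw_quadratic_poly[OF assms(1) r]
  have "p_module r e \<sigma> X H Y l \<subseteq> S2"
    using p_module_weight_bounded by (auto simp: weight_bounded_def)
  moreover have "tangential_developable r e f \<sigma> X Y (k - 2) \<subseteq> proj_points Vf"
    by (auto simp: tangential_developable_def zariski_closure_def)
  ultimately show ?thesis
    using bij prolongation_poly_vanishes_on_secant_variety bij_betw_imp_surj_on[OF bij] by blast
qed

end
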